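(* Let $v_1=e^{\phi_1}$, $v_2=e^{\phi_2}$, $v_3=e^{-\phi_1-\phi_2}$, and let $\Re=\begin{pmatrix}\Re_{11}&\Re_{12}\\ \Re_{21}&\Re_{22}\end{pmatrix}$ be the matrix pseudo-differential operator with entries $$\begin{aligned}\Re_{11}(\phi_1,\phi_2)=&\tfrac13D_x^3+\tfrac23(\phi_{1,x}+\phi_{2,x})D_x^2\\&+\tfrac19(3\phi_{1,xx}-\phi_{1,x}\phi_{2,x}+3\phi_{2,xx}-\phi_{1,x}^2-\phi_{2,x}^2+21v_3^2+3v_2^2+3v_1^2)D_x\\&-\tfrac19(7\phi_{1,x}\phi_{2,xx}+\phi_{1,xx}\phi_{2,x}+2\phi_{1,x}\phi_{1,xx}+2\phi_{2,x}\phi_{2,xx}+4\phi_{1,x}^3+7\phi_{1,x}^2\phi_{2,x}+\phi_{1,x}\phi_{2,x}^2)\\&+\tfrac13(5v_1^2-4v_2^2-7v_3^2)\phi_{1,x}+\tfrac13(8v_1^2-v_2^2-13v_3^2)\phi_{2,x}\\&-\tfrac19\phi_{1,x}D_x^{-1}s_{2,\phi_1}-\tfrac19K_1D_x^{-1}s_{1,\phi_1},\end{aligned}$$ $$\begin{aligned}\Re_{12}(\phi_1,\phi_2)=&\tfrac23D_x^3+\tfrac23\phi_{1,x}D_x^2+\tfrac19(3\phi_{1,xx}-2\phi_{1,x}^2-2\phi_{1,x}\phi_{2,x}-2\phi_{2,x}^2+6v_1^2+24v_2^2+24v_3^2)D_x\\&+\tfrac29(\phi_{1,x}\phi_{1,xx}-\phi_{1,x}\phi_{2,xx}-\phi_{2,x}\phi_{1,xx}-2\phi_{2,x}\phi_{2,xx}-\phi_{1,x}^3-\phi_{1,x}^2\phi_{2,x}-\phi_{1,x}\phi_{2,x}^2)\\&+\tfrac23(v_1^2+v_2^2-5v_3^2)\phi_{1,x}+4(v_2^2-v_3^2)\phi_{2,x}-\tfrac19\phi_{1,x}D_x^{-1}s_{2,\phi_2}-\tfrac19K_1D_x^{-1}s_{1,\phi_2},\end{aligned}$$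 $\Re_{21}(\phi_1,\phi_2)=-\Re_{12}(\phi_2,\phi_1)$, $\Re_{22}(\phi_1,\phi_2)=-\Re_{11}(\phi_2,\phi_1)$, where $$K_1=\phi_{1,xx}+2\phi_{2,xx}+2\phi_{1,x}\phi_{2,x}+\phi_{1,x}^2+3v_2^2-3v_3^2,$$ $$s_{1,\phi_1}=-2\phi_{1,xx}-\phi_{2,xx}-6v_1^2+6v_3^2,\qquad s_{1,\phi_2}=-\phi_{1,xx}-2\phi_{2,xx}-6v_2^2+6v_3^2,$$ $$s_{2,\phi_1}=-3\phi_{2,xxx}-4\phi_{1,x}\phi_{1,xx}+2\phi_{2,x}\phi_{2,xx}-2\phi_{1,xx}\phi_{2,x}-2\phi_{1,x}\phi_{2,xx}-12(v_1^2+v_2^2+v_3^2)\phi_{2,x},$$ $$s_{2,\phi_2}=3\phi_{1,xxx}-2\phi_{1,x}\phi_{1,xx}+4\phi_{2,x}\phi_{2,xx}+2\phi_{1,xx}\phi_{2,x}+2\phi_{1,x}\phi_{2,xx}+12(v_1^2+v_2^2+v_3^2)\phi_{1,x}.$$ Then $\Re$ is a Nijenhuis operator.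
   Context: The dependent variable is $u=(\phi_1,\phi_2)^T$; $\mathcal A$ is the differential ring of smooth functions of $\phi_1,\phi_2$ and finitely many $x$-derivatives, with total derivative $D_x$; $\mathfrak h=\mathcal A^2$ with Lie bracket $[P,Q]=D_Q[P]-D_P[Q]$, where $D_Q=\sum_i\frac{\partial Q}{\partial u_i}D_x^i$ ($u_i=\partial_x^iu$) is the Fréchet derivative. $D_x^{-1}$ is the (left) inverse of $D_x$; operators are formal matrix pseudo-differential operators, and e.g. $\phi_{1,x}D_x^{-1}s$ means $w\mapsto\phi_{1,x}D_x^{-1}(s\,w)$. $F(\phi_2,\phi_1)$ denotes the operator obtained from $F(\phi_1,\phi_2)$ by interchanging $\phi_1$ and $\phi_2$ in every coefficient, after all of them (including $v_i$, $s_{i,\phi_j}$, $K_1$) have been written explicitly in terms of $\phi_1,\phi_2$ and their $x$-derivatives. A linear operator $\Re:\mathfrak h\to\mathfrak h$ is Nijenhuis if $[\Re P,\Re Q]-\Re[\Re P,Q]-\Re[P,\Re Q]+\Re^2[P,Q]=0$ for $P,Q\in\mathfrak h$; equivalently, $D_\Re[\Re P](Q)-\Re D_\Re[P](Q)$ is symmetric in $P$ and $Q$, where $D_\Re[P]$ is the operator obtained by differentiating the coefficients of $\Re$ in the direction $P$. For nonlocal operators these identities are understood formally, with $D_x^{-1}$ as the formal inverse of $D_x$. *)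

theory Defs
  imports "HOL-Analysis.Analysis"
begin

section \<open>The differential ring of the dependent variables\<close>

text \<open>
  The jet coordinate \<open>\<phi>\<^sub>1 k\<close> stands for the \<open>k\<close>-th \<open>x\<close>-derivative of the first dependent
  variable, and similarly for \<open>\<phi>\<^sub>2 k\<close>.
\<close>

datatype jvar = \<phi>\<^sub>1 nat | \<phi>\<^sub>2 nat

type_synonym jet = "jvar \<Rightarrow> real"

definition partial :: "jvar \<Rightarrow> (jet \<Rightarrow> real) \<Rightarrow> jet \<Rightarrow> real" where
  "partial c a = (\<lambda>u. deriv (\<lambda>t. a (u(c := t))) (u c))"

text \<open>
  Smoothness: all iterated partial derivatives exist and are continuous.  For a function of
  finitely many coordinates, continuity in the product topology is the usual continuity.
\<close>

definition smooth_fun :: "(jet \<Rightarrow> real) \<Rightarrow> bool" where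
  "smooth_fun a \<longleftrightarrow>
     (\<forall>cs. continuous_on UNIV (fold partial cs a) \<and>
           (\<forall>c u. (\<lambda>t. fold partial cs a (u(c := t))) differentiable (at (u c))))"

definition diff_funs :: "(jet \<Rightarrow> real) set" where
  "diff_funs = {a. smooth_fun a \<and>
     (\<exists>V. finite V \<and> (\<forall>u w. (\<forall>c\<in>V. u c = w c) \<longrightarrow> a u = a w))}"

definition vars :: "(jet \<Rightarrow> real) \<Rightarrow> jvar set" where
  "vars a = {c. partial c a \<noteq> (\<lambda>u. 0)}"

fun next_var :: "jvar \<Rightarrow> jvar" where
  "next_var (\<phi>\<^sub>1 k) = \<phi>\<^sub>1 (Suc k)"
| "next_var (\<phi>\<^sub>2 k) = \<phi>\<^sub>2 (Suc k)"

text \<open>The sum is finite for members of \<^const>\<open>diff_funs\<close>, the only functions it is used for.\<close>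

definition total_deriv :: "(jet \<Rightarrow> real) \<Rightarrow> jet \<Rightarrow> real" where
  "total_deriv a = (\<lambda>u. \<Sum>c\<in>vars a. partial c a u * u (next_var c))"

section \<open>Formal inversion of the total derivative\<close>

text \<open>
  The total derivative has the constants in its kernel, so no map on the differential ring
  itself can satisfy \<open>D\<^sub>x\<^sup>-\<^sup>1 D\<^sub>x = 1\<close>.  The formal calculus with \<open>D\<^sub>x\<^sup>-\<^sup>1\<close> is rendered as follows:
  the arguments of the operators range over an arbitrary commutative algebra \<open>'m\<close>, without unit,
  over the differential ring, carrying a bijective derivation \<open>D\<close> compatible with the
  total derivative.  Only linearity, the Leibniz rule and \<open>D D\<^sup>-\<^sup>1 = D\<^sup>-\<^sup>1 D = 1\<close> are available.

  Some models: (i) the smooth functions on the real line whose support is bounded below, on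
  which a differential function acts by multiplication with its value along fixed smooth
  \<open>\<phi>\<^sub>1(x)\<close>, \<open>\<phi>\<^sub>2(x)\<close>, and \<open>D\<^sup>-\<^sup>1\<close> is integration from minus infinity; (ii) the space of formal
  symbols \<open>A((\<xi>\<^sup>-\<^sup>1)) \<oplus> A((\<eta>\<^sup>-\<^sup>1)) \<oplus> A((\<eta>\<^sup>-\<^sup>1))((\<xi>\<^sup>-\<^sup>1))\<close> over the differential ring \<open>A\<close>, with \<open>D\<close>
  acting as \<open>D\<^sub>x + \<xi>\<close>, \<open>D\<^sub>x + \<eta>\<close>, \<open>D\<^sub>x + \<xi> + \<eta>\<close> respectively, and with the product of the first two
  summands in the third as the only nonzero product.  In (ii) an identity bilinear in \<open>P\<close>, \<open>Q\<close>
  is an identity of formal bilinear pseudo-differential operators.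
\<close>

locale nonlocal_extension =
  fixes act :: "(jet \<Rightarrow> real) \<Rightarrow> 'm::comm_ring \<Rightarrow> 'm"
    and D :: "'m \<Rightarrow> 'm"
  assumes act_one: "act (\<lambda>u. 1) m = m"
    and act_mult: "\<lbrakk>a \<in> diff_funs; b \<in> diff_funs\<rbrakk> \<Longrightarrow> act (\<lambda>u. a u * b u) m = act a (act b m)"
    and act_add: "\<lbrakk>a \<in> diff_funs; b \<in> diff_funs\<rbrakk> \<Longrightarrow> act (\<lambda>u. a u + b u) m = act a m + act b m"
    and act_add_right: "a \<in> diff_funs \<Longrightarrow> act a (m + n) = act a m + act a n"
    and act_times: "a \<in> diff_funs \<Longrightarrow> act a (m * n) = act a m * n"
    and D_add: "D (m + n) = D m + D n"
    and D_times: "D (m * n) = D m * n + m * D n"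
    and D_act: "a \<in> diff_funs \<Longrightarrow> D (act a m) = act (total_deriv a) m + act a (D m)"
    and D_bij: "bij D"

fun var_direction :: "('m \<Rightarrow> 'm) \<Rightarrow> 'm \<times> 'm \<Rightarrow> jvar \<Rightarrow> 'm" where
  "var_direction D P (\<phi>\<^sub>1 k) = (D ^^ k) (fst P)"
| "var_direction D P (\<phi>\<^sub>2 k) = (D ^^ k) (snd P)"

text \<open>The Frechet derivative \<open>D\<^sub>a[P]\<close> of a differential function \<open>a\<close> in the direction \<open>P\<close>.\<close>

definition coeff_frechet ::
    "((jet \<Rightarrow> real) \<Rightarrow> 'm \<Rightarrow> 'm) \<Rightarrow> ('m \<Rightarrow> 'm) \<Rightarrow> (jet \<Rightarrow> real) \<Rightarrow> 'm \<times> 'm \<Rightarrow> 'm::comm_ring" where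
  "coeff_frechet act D a P = (\<Sum>c\<in>vars a. act (partial c a) (var_direction D P c))"

text \<open>
  A Frechet derivative \<open>fre P m = D\<^sub>m[P]\<close> on the elements of the extension, for which these
  elements are themselves (nonlocal) functions of the dependent variables: it extends the one on
  the differential ring and commutes with \<open>D\<close>, hence with the inverse of \<open>D\<close>.  In model (i) above,
  replace functions by smooth functionals of the pair \<open>(\<phi>\<^sub>1, \<phi>\<^sub>2)\<close> with values in those functions,
  and let \<open>fre\<close> be the directional derivative.
\<close>

locale frechet_extension = nonlocal_extension act D
  for act :: "(jet \<Rightarrow> real) \<Rightarrow> 'm::comm_ring \<Rightarrow> 'm" and D :: "'m \<Rightarrow> 'm" +
  fixes fre :: "'m \<times> 'm \<Rightarrow> 'm \<Rightarrow> 'm"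
  assumes fre_add: "fre P (m + n) = fre P m + fre P n"
    and fre_direction_add: "fre (P + Q) m = fre P m + fre Q m"
    and fre_times: "fre P (m * n) = fre P m * n + m * fre P n"
    and fre_act: "a \<in> diff_funs \<Longrightarrow> fre P (act a m) = coeff_frechet act D a P * m + act a (fre P m)"
    and fre_D: "fre P (D m) = D (fre P m)"

definition lie_bracket :: "('m \<times> 'm \<Rightarrow> 'm \<Rightarrow> 'm) \<Rightarrow> 'm \<times> 'm \<Rightarrow> 'm \<times> 'm \<Rightarrow> 'm \<times> 'm::comm_ring" where
  "lie_bracket fre P Q =
     (fre P (fst Q), fre P (snd Q)) - (fre Q (fst P), fre Q (snd P))"

section \<open>Pseudo-differential operators\<close>

text \<open>
  Operators are given by expressions.  Sum and product of expressions are free constructors, so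
  no algebraic laws hold for them; operators are only compared through their action.
\<close>

datatype pdo =
    Coeff "jet \<Rightarrow> real"
  | Dx
  | Dx_inv
  | Sum pdo pdo
  | Comp pdo pdo

instantiation pdo :: "{plus, one, times, uminus, minus}"
begin
definition plus_pdo :: "pdo \<Rightarrow> pdo \<Rightarrow> pdo" where "plus_pdo = Sum"
definition one_pdo :: pdo where "one_pdo = Coeff (\<lambda>u. 1)"
definition times_pdo :: "pdo \<Rightarrow> pdo \<Rightarrow> pdo" where "times_pdo = Comp"
definition uminus_pdo :: "pdo \<Rightarrow> pdo" where "uminus_pdo X = Comp (Coeff (\<lambda>u. -1)) X"
definition minus_pdo :: "pdo \<Rightarrow> pdo \<Rightarrow> pdo" where "minus_pdo X Y = Sum X (- Y)"
instance ..
end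

instance pdo :: power ..

primrec pdo_apply ::
    "((jet \<Rightarrow> real) \<Rightarrow> 'm \<Rightarrow> 'm) \<Rightarrow> ('m \<Rightarrow> 'm) \<Rightarrow> pdo \<Rightarrow> 'm \<Rightarrow> 'm::comm_ring" where
  "pdo_apply act D (Coeff a) = act a"
| "pdo_apply act D Dx = D"
| "pdo_apply act D Dx_inv = inv D"
| "pdo_apply act D (Sum X Y) = (\<lambda>m. pdo_apply act D X m + pdo_apply act D Y m)"
| "pdo_apply act D (Comp X Y) = (\<lambda>m. pdo_apply act D X (pdo_apply act D Y m))"

text \<open>
  The operator \<open>D\<^sub>X[P]\<close>, obtained from \<open>X\<close> by differentiating the coefficients in the direction \<open>P\<close>.
\<close>

primrec pdo_frechet ::
    "((jet \<Rightarrow> real) \<Rightarrow> 'm \<Rightarrow> 'm) \<Rightarrow> ('m \<Rightarrow> 'm) \<Rightarrow> pdo \<Rightarrow> 'm \<times> 'm \<Rightarrow> 'm \<Rightarrow> 'm::comm_ring" where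
  "pdo_frechet act D (Coeff a) P = (\<lambda>m. coeff_frechet act D a P * m)"
| "pdo_frechet act D Dx P = (\<lambda>m. 0)"
| "pdo_frechet act D Dx_inv P = (\<lambda>m. 0)"
| "pdo_frechet act D (Sum X Y) P = (\<lambda>m. pdo_frechet act D X P m + pdo_frechet act D Y P m)"
| "pdo_frechet act D (Comp X Y) P =
     (\<lambda>m. pdo_frechet act D X P (pdo_apply act D Y m) + pdo_apply act D X (pdo_frechet act D Y P m))"

fun swap_var :: "jvar \<Rightarrow> jvar" where
  "swap_var (\<phi>\<^sub>1 k) = \<phi>\<^sub>2 k"
| "swap_var (\<phi>\<^sub>2 k) = \<phi>\<^sub>1 k"

primrec pdo_swap :: "pdo \<Rightarrow> pdo" where
  "pdo_swap (Coeff a) = Coeff (\<lambda>u. a (\<lambda>c. u (swap_var c)))"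
| "pdo_swap Dx = Dx"
| "pdo_swap Dx_inv = Dx_inv"
| "pdo_swap (Sum X Y) = Sum (pdo_swap X) (pdo_swap Y)"
| "pdo_swap (Comp X Y) = Comp (pdo_swap X) (pdo_swap Y)"

text \<open>\<open>Mat X Y Z W\<close> has first row \<open>X Y\<close> and second row \<open>Z W\<close>.\<close>

datatype pdo_mat = Mat pdo pdo pdo pdo

fun mat_apply ::
    "((jet \<Rightarrow> real) \<Rightarrow> 'm \<Rightarrow> 'm) \<Rightarrow> ('m \<Rightarrow> 'm) \<Rightarrow> pdo_mat \<Rightarrow> 'm \<times> 'm \<Rightarrow> 'm \<times> 'm::comm_ring" where
  "mat_apply act D (Mat X Y Z W) Q =
     (pdo_apply act D X (fst Q) + pdo_apply act D Y (snd Q),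
      pdo_apply act D Z (fst Q) + pdo_apply act D W (snd Q))"

fun mat_frechet ::
    "((jet \<Rightarrow> real) \<Rightarrow> 'm \<Rightarrow> 'm) \<Rightarrow> ('m \<Rightarrow> 'm) \<Rightarrow> pdo_mat \<Rightarrow> 'm \<times> 'm \<Rightarrow> 'm \<times> 'm \<Rightarrow> 'm \<times> 'm::comm_ring" where
  "mat_frechet act D (Mat X Y Z W) P Q =
     (pdo_frechet act D X P (fst Q) + pdo_frechet act D Y P (snd Q),
      pdo_frechet act D Z P (fst Q) + pdo_frechet act D W P (snd Q))"

section \<open>Nijenhuis operators\<close>

definition nijenhuis_bracket ::
    "((jet \<Rightarrow> real) \<Rightarrow> 'm \<Rightarrow> 'm::comm_ring) \<Rightarrow> ('m \<Rightarrow> 'm) \<Rightarrow> ('m \<times> 'm \<Rightarrow> 'm \<Rightarrow> 'm) \<Rightarrow> pdo_mat \<Rightarrow> bool" where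
  "nijenhuis_bracket act D fre R \<longleftrightarrow>
     (let R' = mat_apply act D R; br = lie_bracket fre in
      \<forall>P Q. br (R' P) (R' Q) - R' (br (R' P) Q) - R' (br P (R' Q)) + R' (R' (br P Q)) = 0)"

definition nijenhuis_symmetric ::
    "((jet \<Rightarrow> real) \<Rightarrow> 'm \<Rightarrow> 'm::comm_ring) \<Rightarrow> ('m \<Rightarrow> 'm) \<Rightarrow> pdo_mat \<Rightarrow> bool" where
  "nijenhuis_symmetric act D R \<longleftrightarrow>
     (let R' = mat_apply act D R; dR = mat_frechet act D R in
      \<forall>P Q. dR (R' P) Q - R' (dR P Q) = dR (R' Q) P - R' (dR Q P))"

text \<open>
  The symmetric form needs only the Frechet derivatives of the coefficients of the operator and is
  required in the given extension as it stands; the bracket form is required for every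
  Frechet derivative on it.
\<close>

definition nijenhuis ::
    "((jet \<Rightarrow> real) \<Rightarrow> 'm \<Rightarrow> 'm::comm_ring) \<Rightarrow> ('m \<Rightarrow> 'm) \<Rightarrow> pdo_mat \<Rightarrow> bool" where
  "nijenhuis act D R \<longleftrightarrow>
     nijenhuis_symmetric act D R \<and>
     (\<forall>fre. frechet_extension act D fre \<longrightarrow> nijenhuis_bracket act D fre R)"

section \<open>The operator\<close>

definition v1 :: "jet \<Rightarrow> real" where "v1 u = exp (u (\<phi>\<^sub>1 0))"
definition v2 :: "jet \<Rightarrow> real" where "v2 u = exp (u (\<phi>\<^sub>2 0))"
definition v3 :: "jet \<Rightarrow> real" where "v3 u = exp (- u (\<phi>\<^sub>1 0) - u (\<phi>\<^sub>2 0))"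

definition K1 :: "jet \<Rightarrow> real" where
  "K1 u = u (\<phi>\<^sub>1 2) + 2 * u (\<phi>\<^sub>2 2) + 2 * u (\<phi>\<^sub>1 1) * u (\<phi>\<^sub>2 1) + (u (\<phi>\<^sub>1 1))\<^sup>2
     + 3 * (v2 u)\<^sup>2 - 3 * (v3 u)\<^sup>2"

text \<open>\<open>s11\<close>, \<open>s12\<close>, \<open>s21\<close>, \<open>s22\<close> stand for \<open>s\<^sub>1\<^sub>,\<^sub>\<phi>\<^sub>1\<close>, \<open>s\<^sub>1\<^sub>,\<^sub>\<phi>\<^sub>2\<close>, \<open>s\<^sub>2\<^sub>,\<^sub>\<phi>\<^sub>1\<close>, \<open>s\<^sub>2\<^sub>,\<^sub>\<phi>\<^sub>2\<close>.\<close>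

definition s11 :: "jet \<Rightarrow> real" where
  "s11 u = - 2 * u (\<phi>\<^sub>1 2) - u (\<phi>\<^sub>2 2) - 6 * (v1 u)\<^sup>2 + 6 * (v3 u)\<^sup>2"

definition s12 :: "jet \<Rightarrow> real" where
  "s12 u = - u (\<phi>\<^sub>1 2) - 2 * u (\<phi>\<^sub>2 2) - 6 * (v2 u)\<^sup>2 + 6 * (v3 u)\<^sup>2"

definition s21 :: "jet \<Rightarrow> real" where
  "s21 u = - 3 * u (\<phi>\<^sub>2 3) - 4 * u (\<phi>\<^sub>1 1) * u (\<phi>\<^sub>1 2) + 2 * u (\<phi>\<^sub>2 1) * u (\<phi>\<^sub>2 2)
     - 2 * u (\<phi>\<^sub>1 2) * u (\<phi>\<^sub>2 1) - 2 * u (\<phi>\<^sub>1 1) * u (\<phi>\<^sub>2 2)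
     - 12 * ((v1 u)\<^sup>2 + (v2 u)\<^sup>2 + (v3 u)\<^sup>2) * u (\<phi>\<^sub>2 1)"

definition s22 :: "jet \<Rightarrow> real" where
  "s22 u = 3 * u (\<phi>\<^sub>1 3) - 2 * u (\<phi>\<^sub>1 1) * u (\<phi>\<^sub>1 2) + 4 * u (\<phi>\<^sub>2 1) * u (\<phi>\<^sub>2 2)
     + 2 * u (\<phi>\<^sub>1 2) * u (\<phi>\<^sub>2 1) + 2 * u (\<phi>\<^sub>1 1) * u (\<phi>\<^sub>2 2)
     + 12 * ((v1 u)\<^sup>2 + (v2 u)\<^sup>2 + (v3 u)\<^sup>2) * u (\<phi>\<^sub>1 1)"

definition R11 :: pdo where
  "R11 =
     Coeff (\<lambda>u. 1/3) * Dx ^ 3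
   + Coeff (\<lambda>u. 2/3 * (u (\<phi>\<^sub>1 1) + u (\<phi>\<^sub>2 1))) * Dx ^ 2
   + Coeff (\<lambda>u. 1/9 * (3 * u (\<phi>\<^sub>1 2) - u (\<phi>\<^sub>1 1) * u (\<phi>\<^sub>2 1) + 3 * u (\<phi>\<^sub>2 2)
         - (u (\<phi>\<^sub>1 1))\<^sup>2 - (u (\<phi>\<^sub>2 1))\<^sup>2
         + 21 * (v3 u)\<^sup>2 + 3 * (v2 u)\<^sup>2 + 3 * (v1 u)\<^sup>2)) * Dx
   - Coeff (\<lambda>u. 1/9 * (7 * u (\<phi>\<^sub>1 1) * u (\<phi>\<^sub>2 2) + u (\<phi>\<^sub>1 2) * u (\<phi>\<^sub>2 1)
         + 2 * u (\<phi>\<^sub>1 1) * u (\<phi>\<^sub>1 2) + 2 * u (\<phi>\<^sub>2 1) * u (\<phi>\<^sub>2 2)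
         + 4 * (u (\<phi>\<^sub>1 1)) ^ 3 + 7 * (u (\<phi>\<^sub>1 1))\<^sup>2 * u (\<phi>\<^sub>2 1) + u (\<phi>\<^sub>1 1) * (u (\<phi>\<^sub>2 1))\<^sup>2))
   + Coeff (\<lambda>u. 1/3 * (5 * (v1 u)\<^sup>2 - 4 * (v2 u)\<^sup>2 - 7 * (v3 u)\<^sup>2) * u (\<phi>\<^sub>1 1))
   + Coeff (\<lambda>u. 1/3 * (8 * (v1 u)\<^sup>2 - (v2 u)\<^sup>2 - 13 * (v3 u)\<^sup>2) * u (\<phi>\<^sub>2 1))
   - Coeff (\<lambda>u. 1/9 * u (\<phi>\<^sub>1 1)) * Dx_inv * Coeff s21
   - Coeff (\<lambda>u. 1/9 * K1 u) * Dx_inv * Coeff s11"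

definition R12 :: pdo where
  "R12 =
     Coeff (\<lambda>u. 2/3) * Dx ^ 3
   + Coeff (\<lambda>u. 2/3 * u (\<phi>\<^sub>1 1)) * Dx ^ 2
   + Coeff (\<lambda>u. 1/9 * (3 * u (\<phi>\<^sub>1 2) - 2 * (u (\<phi>\<^sub>1 1))\<^sup>2 - 2 * u (\<phi>\<^sub>1 1) * u (\<phi>\<^sub>2 1)
         - 2 * (u (\<phi>\<^sub>2 1))\<^sup>2
         + 6 * (v1 u)\<^sup>2 + 24 * (v2 u)\<^sup>2 + 24 * (v3 u)\<^sup>2)) * Dx
   + Coeff (\<lambda>u. 2/9 * (u (\<phi>\<^sub>1 1) * u (\<phi>\<^sub>1 2) - u (\<phi>\<^sub>1 1) * u (\<phi>\<^sub>2 2)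
         - u (\<phi>\<^sub>2 1) * u (\<phi>\<^sub>1 2) - 2 * u (\<phi>\<^sub>2 1) * u (\<phi>\<^sub>2 2)
         - (u (\<phi>\<^sub>1 1)) ^ 3 - (u (\<phi>\<^sub>1 1))\<^sup>2 * u (\<phi>\<^sub>2 1) - u (\<phi>\<^sub>1 1) * (u (\<phi>\<^sub>2 1))\<^sup>2))
   + Coeff (\<lambda>u. 2/3 * ((v1 u)\<^sup>2 + (v2 u)\<^sup>2 - 5 * (v3 u)\<^sup>2) * u (\<phi>\<^sub>1 1))
   + Coeff (\<lambda>u. 4 * ((v2 u)\<^sup>2 - (v3 u)\<^sup>2) * u (\<phi>\<^sub>2 1))
   - Coeff (\<lambda>u. 1/9 * u (\<phi>\<^sub>1 1)) * Dx_inv * Coeff s22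
   - Coeff (\<lambda>u. 1/9 * K1 u) * Dx_inv * Coeff s12"

definition R_op :: pdo_mat where
  "R_op = Mat R11 R12 (- pdo_swap R12) (- pdo_swap R11)"

end

theory Submission
  imports Defs
begin

text \<open>
  Write \<open>R = L + \<Sum>\<^sub>l A\<^sub>l D\<^sup>-\<^sup>1 s\<^sub>l\<close>.  With the nonlocal quantities \<open>W\<^sub>l(P) = D\<^sup>-\<^sup>1 (s\<^sub>l \<cdot> P)\<close> as
  generators besides the jets \<open>D\<^sup>k P\<^sub>i\<close>, the element \<open>R P\<close> is a linear form in the generators, and
  \<open>D\<close> acts on linear and bilinear forms symbolically because \<open>D W\<^sub>l(P) = s\<^sub>l \<cdot> P\<close>.

  In \<open>R'[R P] Q - R R'[P] Q\<close> the inverse of \<open>D\<close> is further applied to \<open>D\<^bsub>s\<^sub>l\<^esub>[P] \<cdot> Q\<close> and to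
  \<open>X\<^sub>l = D\<^bsub>s\<^sub>l\<^esub>[R P] \<cdot> Q - s\<^sub>l \<cdot> R'[P] Q\<close>.  Up to terms symmetric in \<open>P\<close> and \<open>Q\<close> both are total
  derivatives, \<open>D \<beta>\<^sub>l\<close> and \<open>D \<upsilon>\<^sub>l\<close>, of explicit bilinear forms: the Frechet derivatives of \<open>s\<^sub>l\<close> and of
  the next gradient \<open>R\<^sup>* s\<^sub>l\<close> are self-adjoint.  So every inverse cancels, and what remains is the
  symmetry of finitely many bilinear forms whose coefficients are polynomials in the jet
  coordinates and in \<open>E\<^sub>i = v\<^sub>i\<^sup>2\<close>, which may be treated as independent.
\<close>

section \<open>The coefficient ring\<close>

text \<open>Syntax is used because partial derivatives of expressions are again expressions, which
  settles all iterated derivatives at once, and because an expression has finitely many variables.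
  The functions \<open>v1\<close>, \<open>v2\<close>, \<open>v3\<close> enter the operator only
  through their squares, so the squares are the atoms.\<close>

datatype jet_expr = Const real | Jet jvar | Sq1 | Sq2 | Sq3 | Plus jet_expr jet_expr
    | Times jet_expr jet_expr

primrec eval_expr :: "jet_expr \<Rightarrow> jet \<Rightarrow> real" where
  "eval_expr (Const r) = (\<lambda>u. r)"
| "eval_expr (Jet v) = (\<lambda>u. u v)"
| "eval_expr Sq1 = (\<lambda>u. (v1 u)\<^sup>2)"
| "eval_expr Sq2 = (\<lambda>u. (v2 u)\<^sup>2)"
| "eval_expr Sq3 = (\<lambda>u. (v3 u)\<^sup>2)"
| "eval_expr (Plus a b) = (\<lambda>u. eval_expr a u + eval_expr b u)"
| "eval_expr (Times a b) = (\<lambda>u. eval_expr a u * eval_expr b u)"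

definition delta :: "jvar \<Rightarrow> jvar \<Rightarrow> real" where
  [simp]: "delta v w = (if v = w then 1 else 0)"

primrec partial_expr :: "jvar \<Rightarrow> jet_expr \<Rightarrow> jet_expr" where
  "partial_expr v (Const r) = Const 0"
| "partial_expr v (Jet w) = Const (delta v w)"
| "partial_expr v Sq1 = Times (Const (2 * delta v (\<phi>\<^sub>1 0))) Sq1"
| "partial_expr v Sq2 = Times (Const (2 * delta v (\<phi>\<^sub>2 0))) Sq2"
| "partial_expr v Sq3 = Times (Const (- 2 * (delta v (\<phi>\<^sub>1 0) + delta v (\<phi>\<^sub>2 0)))) Sq3"
| "partial_expr v (Plus a b) = Plus (partial_expr v a) (partial_expr v b)"
| "partial_expr v (Times a b) = Plus (Times (partial_expr v a) b) (Times a (partial_expr v b))"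

lemma has_partial_eval_expr:
  "((\<lambda>t. eval_expr c (u(v := t))) has_field_derivative eval_expr (partial_expr v c) (u(v := t))) (at
      t)"
proof (induction c)
  case (Jet w)
  then show ?case by (cases "v = w") auto
next
  case (Times a b)
  then show ?case by (auto intro!: derivative_eq_intros)
next
  case (Plus a b)
  then show ?case by (auto intro!: derivative_eq_intros)
qed (auto simp: v1_def v2_def v3_def power2_eq_square intro!: derivative_eq_intros)

lemma partial_eval_expr: "partial v (eval_expr c) = eval_expr (partial_expr v c)"
  unfolding partial_def using DERIV_imp_deriv[OF has_partial_eval_expr[of c _ v]] by fastforce

lemma continuous_eval_expr: "continuous_on UNIV (eval_expr c)"
  by (induction c) (auto simp: v1_def v2_def v3_def intro!: continuous_intros)

lemma fold_partial_eval_expr: "\<exists>d. fold partial cs (eval_expr c) = eval_expr d"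
  by (induction cs arbitrary: c) (auto simp: partial_eval_expr)

lemma smooth_eval_expr: "smooth_fun (eval_expr c)"
  unfolding smooth_fun_def
proof (intro allI conjI)
  fix cs v u
  obtain d where d: "fold partial cs (eval_expr c) = eval_expr d" using fold_partial_eval_expr
      by blast
  show "continuous_on UNIV (fold partial cs (eval_expr c))" by (simp add: d continuous_eval_expr)
  show "(\<lambda>t. fold partial cs (eval_expr c) (u(v := t))) differentiable at (u v)"
    unfolding d differentiable_def
    using has_partial_eval_expr has_field_derivative_imp_has_derivative by blast
qed

primrec expr_vars :: "jet_expr \<Rightarrow> jvar set" where
  "expr_vars (Const r) = {}"
| "expr_vars (Jet v) = {v}"
| "expr_vars Sq1 = {\<phi>\<^sub>1 0}"
| "expr_vars Sq2 = {\<phi>\<^sub>2 0}"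
| "expr_vars Sq3 = {\<phi>\<^sub>1 0, \<phi>\<^sub>2 0}"
| "expr_vars (Plus a b) = expr_vars a \<union> expr_vars b"
| "expr_vars (Times a b) = expr_vars a \<union> expr_vars b"

lemma finite_expr_vars: "finite (expr_vars c)"
  by (induction c) auto

lemma eval_expr_cong: "(\<And>v. v \<in> expr_vars c \<Longrightarrow> u v = w v) \<Longrightarrow> eval_expr c u = eval_expr c w"
  by (induction c) (auto simp: v1_def v2_def v3_def)

lemma eval_expr_diff_funs: "eval_expr c \<in> diff_funs"
  unfolding diff_funs_def
proof (intro CollectI conjI exI[of _ "expr_vars c"] allI impI)
  show "eval_expr c u = eval_expr c w" if "\<forall>v\<in>expr_vars c. u v = w v" for u w
    using that by (intro eval_expr_cong) blast
qed (simp_all add: smooth_eval_expr finite_expr_vars)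

lemma partial_expr_eq_0: "v \<notin> expr_vars c \<Longrightarrow> eval_expr (partial_expr v c) u = 0"
  by (induction c) auto

text \<open>Only an inclusion: a variable can occur in an expression whose value does not depend on
  it.\<close>

lemma vars_eval_expr: "vars (eval_expr c) \<subseteq> expr_vars c"
  unfolding vars_def partial_eval_expr using partial_expr_eq_0 by blast

primrec total_expr :: "jet_expr \<Rightarrow> jet_expr" where
  "total_expr (Const r) = Const 0"
| "total_expr (Jet v) = Jet (next_var v)"
| "total_expr Sq1 = Times (Times (Const 2) (Jet (\<phi>\<^sub>1 1))) Sq1"
| "total_expr Sq2 = Times (Times (Const 2) (Jet (\<phi>\<^sub>2 1))) Sq2"
| "total_expr Sq3 = Times (Times (Const (- 2)) (Plus (Jet (\<phi>\<^sub>1 1)) (Jet (\<phi>\<^sub>2 1)))) Sq3"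
| "total_expr (Plus a b) = Plus (total_expr a) (total_expr b)"
| "total_expr (Times a b) = Plus (Times (total_expr a) b) (Times a (total_expr b))"

text \<open>Any finite superset of the variables is allowed, so that the induction can use one index
  set for both arguments of a sum or product.\<close>

lemma sum_partial_expr:
  assumes "finite V"
  shows "expr_vars c \<subseteq> V
      \<Longrightarrow> (\<Sum>v\<in>V. eval_expr (partial_expr v c) u * u (next_var v)) = eval_expr (total_expr c) u"
  using assms
proof (induction c)
  case (Jet w)
  have "(\<Sum>v\<in>V. delta v w * u (next_var v)) = (\<Sum>v\<in>V. if v = w then u (next_var v) else 0)"
    by (rule sum.cong) auto
  with Jet show ?case by simp
next
  case Sq1
  have "(\<Sum>v\<in>V. 2 * delta v (\<phi>\<^sub>1 0) * (v1 u)\<^sup>2 * u (next_var v))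
     = (\<Sum>v\<in>V. if v = \<phi>\<^sub>1 0 then 2 * (v1 u)\<^sup>2 * u (next_var v) else 0)"
    by (rule sum.cong) auto
  with Sq1 show ?case by simp
next
  case Sq2
  have "(\<Sum>v\<in>V. 2 * delta v (\<phi>\<^sub>2 0) * (v2 u)\<^sup>2 * u (next_var v))
     = (\<Sum>v\<in>V. if v = \<phi>\<^sub>2 0 then 2 * (v2 u)\<^sup>2 * u (next_var v) else 0)"
    by (rule sum.cong) auto
  with Sq2 show ?case by simp
next
  case Sq3
  have "(\<Sum>v\<in>V. - 2 * (delta v (\<phi>\<^sub>1 0) + delta v (\<phi>\<^sub>2 0)) * (v3 u)\<^sup>2 * u (next_var v))
     = (\<Sum>v\<in>V. (if v = \<phi>\<^sub>1 0 then - 2 * (v3 u)\<^sup>2 * u (next_var v) else 0)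
           + (if v = \<phi>\<^sub>2 0 then - 2 * (v3 u)\<^sup>2 * u (next_var v) else 0))"
    by (rule sum.cong) auto
  with Sq3 show ?case by (simp add: sum.distrib algebra_simps)
next
  case (Plus a b)
  then show ?case by (simp add: sum.distrib algebra_simps)
next
  case (Times a b)
  have "(\<Sum>v\<in>V. eval_expr (partial_expr v (Times a b)) u * u (next_var v))
     = eval_expr b u * (\<Sum>v\<in>V. eval_expr (partial_expr v a) u * u (next_var v))
     + eval_expr a u * (\<Sum>v\<in>V. eval_expr (partial_expr v b) u * u (next_var v))"
    by (simp add: sum.distrib sum_distrib_left algebra_simps)
  with Times show ?case by (simp add: algebra_simps)
qed simp

lemma total_deriv_eval_expr: "total_deriv (eval_expr c) = eval_expr (total_expr c)"
proof
  fix u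
  have "(\<Sum>v\<in>vars (eval_expr c). partial v (eval_expr c) u * u (next_var v))
     = (\<Sum>v\<in>expr_vars c. partial v (eval_expr c) u * u (next_var v))"
  proof (rule sum.mono_neutral_left)
    show "\<forall>v\<in>expr_vars c - vars (eval_expr c). partial v (eval_expr c) u * u (next_var v) = 0"
      by (simp add: vars_def)
  qed (simp_all add: finite_expr_vars vars_eval_expr)
  then show "total_deriv (eval_expr c) u = eval_expr (total_expr c) u"
    by (simp add: total_deriv_def partial_eval_expr sum_partial_expr finite_expr_vars)
qed

primrec swap_expr :: "jet_expr \<Rightarrow> jet_expr" where
  "swap_expr (Const r) = Const r"
| "swap_expr (Jet v) = Jet (swap_var v)"
| "swap_expr Sq1 = Sq2"
| "swap_expr Sq2 = Sq1"
| "swap_expr Sq3 = Sq3"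
| "swap_expr (Plus a b) = Plus (swap_expr a) (swap_expr b)"
| "swap_expr (Times a b) = Times (swap_expr a) (swap_expr b)"

lemma eval_expr_swap: "eval_expr c (\<lambda>v. u (swap_var v)) = eval_expr (swap_expr c) u"
  by (induction c) (auto simp: v1_def v2_def v3_def intro: arg_cong[where f = exp])

text \<open>
  All coefficients lie in the ring generated by the constants, the jet coordinates and the squares
  \<open>E\<^sub>i = v\<^sub>i\<^sup>2\<close>.  As a type, it makes the ring and derivation laws available to rewriting.
\<close>

typedef jetfun = "range eval_expr"
  morphisms fn Abs_jetfun by blast

setup_lifting type_definition_jetfun

lemma fn_cases: obtains c where "fn a = eval_expr c"
  using fn[of a] by blast

lemma range_eval_expr:
  "(\<lambda>u. r) \<in> range eval_expr" "(\<lambda>u. u v) \<in> range eval_expr"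
  "(\<lambda>u. (v1 u)\<^sup>2) \<in> range eval_expr" "(\<lambda>u. (v2 u)\<^sup>2) \<in> range eval_expr"
      "(\<lambda>u. (v3 u)\<^sup>2) \<in> range eval_expr"
  "a \<in> range eval_expr \<Longrightarrow> b \<in> range eval_expr \<Longrightarrow> (\<lambda>u. a u + b u) \<in> range eval_expr"
  "a \<in> range eval_expr \<Longrightarrow> b \<in> range eval_expr \<Longrightarrow> (\<lambda>u. a u * b u) \<in> range eval_expr"
  "a \<in> range eval_expr \<Longrightarrow> (\<lambda>u. - a u) \<in> range eval_expr"
proof -
  show "(\<lambda>u. r) \<in> range eval_expr" using rangeI[of eval_expr "Const r"] by simp
  show "(\<lambda>u. u v) \<in> range eval_expr" using rangeI[of eval_expr "Jet v"] by simp
  show "(\<lambda>u. (v1 u)\<^sup>2) \<in> range eval_expr" using rangeI[of eval_expr Sq1] by simp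
  show "(\<lambda>u. (v2 u)\<^sup>2) \<in> range eval_expr" using rangeI[of eval_expr Sq2] by simp
  show "(\<lambda>u. (v3 u)\<^sup>2) \<in> range eval_expr" using rangeI[of eval_expr Sq3] by simp
next
  assume "a \<in> range eval_expr" "b \<in> range eval_expr"
  then obtain c d where cd: "a = eval_expr c" "b = eval_expr d" by (elim rangeE)
  show "(\<lambda>u. a u + b u) \<in> range eval_expr"
    using rangeI[of eval_expr "Plus c d"] by (simp add: cd)
  show "(\<lambda>u. a u * b u) \<in> range eval_expr"
    using rangeI[of eval_expr "Times c d"] by (simp add: cd)
next
  assume "a \<in> range eval_expr"
  then obtain c where c: "a = eval_expr c" by (elim rangeE)
  show "(\<lambda>u. - a u) \<in> range eval_expr"
    using rangeI[of eval_expr "Times (Const (- 1)) c"] by (simp add: c)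
qed

instantiation jetfun :: comm_ring_1
begin
lift_definition zero_jetfun :: jetfun is "\<lambda>u. 0" by (rule range_eval_expr)
lift_definition one_jetfun :: jetfun is "\<lambda>u. 1" by (rule range_eval_expr)
lift_definition plus_jetfun :: "jetfun \<Rightarrow> jetfun \<Rightarrow> jetfun" is "\<lambda>a b u. a u + b u"
  by (rule range_eval_expr)
lift_definition times_jetfun :: "jetfun \<Rightarrow> jetfun \<Rightarrow> jetfun" is "\<lambda>a b u. a u * b u"
  by (rule range_eval_expr)
lift_definition uminus_jetfun :: "jetfun \<Rightarrow> jetfun" is "\<lambda>a u. - a u" by (rule range_eval_expr)
definition minus_jetfun :: "jetfun \<Rightarrow> jetfun \<Rightarrow> jetfun" where
  "minus_jetfun a b = a + - b"
instance
proof
  fix a b c :: jetfun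
  note r = zero_jetfun.rep_eq one_jetfun.rep_eq plus_jetfun.rep_eq times_jetfun.rep_eq
    uminus_jetfun.rep_eq minus_jetfun_def
  note eqI = fn_inject[THEN iffD1, OF ext]
  show "a + b + c = a + (b + c)" by (rule eqI) (simp add: r add.assoc)
  show "a + b = b + a" by (rule eqI) (simp add: r add.commute)
  show "0 + a = a" by (rule eqI) (simp add: r)
  show "- a + a = 0" by (rule eqI) (simp add: r)
  show "a - b = a + - b" by (simp add: r)
  show "a * b * c = a * (b * c)" by (rule eqI) (simp add: r mult.assoc)
  show "a * b = b * a" by (rule eqI) (simp add: r mult.commute)
  show "1 * a = a" by (rule eqI) (simp add: r)
  show "(a + b) * c = a * c + b * c" by (rule eqI) (simp add: r distrib_right)
  show "(0 :: jetfun) \<noteq> 1"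
  proof
    assume "(0 :: jetfun) = 1"
    then have "fn 0 undefined = fn 1 undefined" by simp
    then show False by (simp add: r)
  qed
qed
end

lift_definition jconst :: "real \<Rightarrow> jetfun" is "\<lambda>r u. r" by (rule range_eval_expr)
lift_definition jv :: "jvar \<Rightarrow> jetfun" is "\<lambda>v u. u v" by (rule range_eval_expr)
lift_definition E1 :: jetfun is "\<lambda>u. (v1 u)\<^sup>2" by (rule range_eval_expr)
lift_definition E2 :: jetfun is "\<lambda>u. (v2 u)\<^sup>2" by (rule range_eval_expr)
lift_definition E3 :: jetfun is "\<lambda>u. (v3 u)\<^sup>2" by (rule range_eval_expr)
lift_definition pd :: "jvar \<Rightarrow> jetfun \<Rightarrow> jetfun" is partial
  by (auto simp: partial_eval_expr)
lift_definition dt :: "jetfun \<Rightarrow> jetfun" is total_deriv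
  by (auto simp: total_deriv_eval_expr)
lift_definition swp :: "jetfun \<Rightarrow> jetfun" is "\<lambda>a u. a (\<lambda>v. u (swap_var v))"
  by (auto simp: eval_expr_swap)

lemma fn_diff_funs: "fn a \<in> diff_funs"
  by (rule fn_cases[of a]) (simp add: eval_expr_diff_funs)

lemma fn_simps:
  "fn 0 u = 0" "fn 1 u = 1" "fn (a + b) u = fn a u + fn b u" "fn (a * b) u = fn a u * fn b u"
  "fn (- a) u = - fn a u" "fn (a - b) u = fn a u - fn b u" "fn (numeral n) u = numeral n"
  "fn (a ^ k) u = fn a u ^ k"
  "fn (jconst r) u = r" "fn (jv v) u = u v"
  "fn E1 u = (v1 u)\<^sup>2" "fn E2 u = (v2 u)\<^sup>2" "fn E3 u = (v3 u)\<^sup>2"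
  "fn (swp a) u = fn a (\<lambda>v. u (swap_var v))"
proof -
  show *: "fn 0 u = 0" "fn 1 u = 1" "fn (a + b) u = fn a u + fn b u" "fn (a * b) u = fn a u * fn b u"
    "fn (- a) u = - fn a u" "fn (jconst r) u = r" "fn (jv v) u = u v"
    "fn E1 u = (v1 u)\<^sup>2" "fn E2 u = (v2 u)\<^sup>2" "fn E3 u = (v3 u)\<^sup>2"
    "fn (swp a) u = fn a (\<lambda>v. u (swap_var v))" for a b
    by (simp_all add: zero_jetfun.rep_eq one_jetfun.rep_eq plus_jetfun.rep_eq times_jetfun.rep_eq
        uminus_jetfun.rep_eq jconst.rep_eq jv.rep_eq E1.rep_eq E2.rep_eq E3.rep_eq swp.rep_eq)
  show "fn (a - b) u = fn a u - fn b u"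
    by (simp only: minus_jetfun_def * diff_conv_add_uminus)
  show "fn (numeral n) u = numeral n"
    by (induction n) (simp_all only: numeral_One numeral_Bit0 numeral_Bit1 *)
  show "fn (a ^ k) u = fn a u ^ k"
    by (induction k) (simp_all add: *)
qed

lemma jetfun_eqI: "(\<And>u. fn a u = fn b u) \<Longrightarrow> a = b"
  by (rule fn_inject[THEN iffD1, OF ext])

lemma pd_simps:
  "pd v 0 = 0" "pd v 1 = 0" "pd v (a + b) = pd v a + pd v b"
  "pd v (a * b) = pd v a * b + a * pd v b" "pd v (jconst r) = 0"
  "pd v (jv w) = (if v = w then 1 else 0)"
  "pd v E1 = (if v = \<phi>\<^sub>1 0 then 2 * E1 else 0)"
  "pd v E2 = (if v = \<phi>\<^sub>2 0 then 2 * E2 else 0)"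
  "pd v E3 = (if v = \<phi>\<^sub>1 0 \<or> v = \<phi>\<^sub>2 0 then - 2 * E3 else 0)"
proof -
  obtain c where c: "fn a = eval_expr c" by (rule fn_cases)
  obtain d where d: "fn b = eval_expr d" by (rule fn_cases)
  \<comment> \<open>Any expression with the values of \<open>e\<close> computes the derivative, so
    each rule is read off from \<open>partial_expr\<close> at a convenient expression.\<close>
  have *: "fn (pd v e) = eval_expr (partial_expr v f)" if "\<And>u. fn e u = eval_expr f u" for e f
  proof -
    have "fn e = eval_expr f" using that by (rule ext)
    then show ?thesis by (simp add: pd.rep_eq partial_eval_expr)
  qed
  note f = *[of 0 "Const 0"] *[of 1 "Const 1"] *[of "a + b" "Plus c d"] *[of "a * b" "Times c d"]
    *[of "jconst r" "Const r"] *[of "jv w" "Jet w"] *[of E1 Sq1] *[of E2 Sq2] *[of E3 Sq3]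
    *[of a c] *[of b d]
  note f' = f[simplified fn_simps eval_expr.simps c d, OF refl]
  show "pd v 0 = 0" "pd v 1 = 0" "pd v (a + b) = pd v a + pd v b"
      "pd v (a * b) = pd v a * b + a * pd v b" "pd v (jconst r) = 0"
      "pd v (jv w) = (if v = w then 1 else 0)" "pd v E1 = (if v = \<phi>\<^sub>1 0 then 2 * E1 else 0)"
      "pd v E2 = (if v = \<phi>\<^sub>2 0 then 2 * E2 else 0)"
      "pd v E3 = (if v = \<phi>\<^sub>1 0 \<or> v = \<phi>\<^sub>2 0 then - 2 * E3 else 0)"
    by (rule jetfun_eqI; simp add: f' fn_simps c d)+
qed

lemma dt_simps:
  "dt 0 = 0" "dt 1 = 0" "dt (a + b) = dt a + dt b"
  "dt (a * b) = dt a * b + a * dt b" "dt (jconst r) = 0"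
  "dt (jv v) = jv (next_var v)"
  "dt E1 = 2 * jv (\<phi>\<^sub>1 1) * E1"
  "dt E2 = 2 * jv (\<phi>\<^sub>2 1) * E2"
  "dt E3 = - 2 * (jv (\<phi>\<^sub>1 1) + jv (\<phi>\<^sub>2 1)) * E3"
proof -
  obtain c where c: "fn a = eval_expr c" by (rule fn_cases)
  obtain d where d: "fn b = eval_expr d" by (rule fn_cases)
  have *: "fn (dt e) = eval_expr (total_expr f)" if "\<And>u. fn e u = eval_expr f u" for e f
  proof -
    have "fn e = eval_expr f" using that by (rule ext)
    then show ?thesis by (simp add: dt.rep_eq total_deriv_eval_expr)
  qed
  note f = *[of 0 "Const 0"] *[of 1 "Const 1"] *[of "a + b" "Plus c d"] *[of "a * b" "Times c d"]
    *[of "jconst r" "Const r"] *[of "jv v" "Jet v"] *[of E1 Sq1] *[of E2 Sq2] *[of E3 Sq3]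
    *[of a c] *[of b d]
  note f' = f[simplified fn_simps eval_expr.simps c d, OF refl]
  show "dt 0 = 0" "dt 1 = 0" "dt (a + b) = dt a + dt b" "dt (a * b) = dt a * b + a * dt b"
      "dt (jconst r) = 0" "dt (jv v) = jv (next_var v)" "dt E1 = 2 * jv (\<phi>\<^sub>1 1) * E1"
      "dt E2 = 2 * jv (\<phi>\<^sub>2 1) * E2" "dt E3 = - 2 * (jv (\<phi>\<^sub>1 1) + jv (\<phi>\<^sub>2 1)) * E3"
    by (rule jetfun_eqI; simp add: f' fn_simps c d)+
qed

lemma pd_numeral: "pd v (numeral n) = 0"
  by (induction n) (simp_all only: numeral_One numeral_Bit0 numeral_Bit1 pd_simps add_0)

lemma dt_numeral: "dt (numeral n) = 0"
  by (induction n) (simp_all only: numeral_One numeral_Bit0 numeral_Bit1 dt_simps add_0)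

lemma pd_uminus: "pd v (- a) = - pd v a"
  using pd_simps(3)[of v a "- a"] by (simp add: pd_simps(1) eq_neg_iff_add_eq_0 add.commute)

lemma dt_uminus: "dt (- a) = - dt a"
  using dt_simps(3)[of a "- a"] by (simp add: dt_simps(1) eq_neg_iff_add_eq_0 add.commute)

lemma pd_minus: "pd v (a - b) = pd v a - pd v b"
  using pd_simps(3)[of v a "- b"] by (simp add: pd_uminus)

lemma dt_minus: "dt (a - b) = dt a - dt b"
  using dt_simps(3)[of a "- b"] by (simp add: dt_uminus)

lemmas pd_rules = pd_simps pd_numeral pd_uminus pd_minus
lemmas dt_rules = dt_simps dt_numeral dt_uminus dt_minus

lemma swp_rules:
  "swp 0 = 0" "swp 1 = 1" "swp (a + b) = swp a + swp b" "swp (a * b) = swp a * swp b"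
  "swp (- a) = - swp a" "swp (a - b) = swp a - swp b" "swp (numeral n) = numeral n"
  "swp (a ^ k) = swp a ^ k"
  "swp (jconst r) = jconst r" "swp (jv v) = jv (swap_var v)"
  "swp E1 = E2" "swp E2 = E1" "swp E3 = E3"
  by (rule jetfun_eqI; simp add: fn_simps v1_def v2_def v3_def algebra_simps)+

section \<open>Coefficients of linear and bilinear forms\<close>

text \<open>
  For an argument \<open>P\<close>, the generators \<open>p\<^sub>k\<close>, \<open>q\<^sub>k\<close> stand for \<open>D\<^sup>k P\<^sub>1\<close>, \<open>D\<^sup>k P\<^sub>2\<close> and \<open>W\<^sub>l\<close> for
  \<open>D\<^sup>-\<^sup>1 (s\<^sub>l \<cdot> P)\<close>; the coefficients \<open>a\<^sub>k\<close>, \<open>b\<^sub>k\<close> are the jet coordinates of \<open>\<phi>\<^sub>1\<close>, \<open>\<phi>\<^sub>2\<close>.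
\<close>

datatype gen = J jvar | W1 | W2
datatype component = C1 | C2

abbreviation p0 where "p0 \<equiv> J (\<phi>\<^sub>1 0)"
abbreviation q0 where "q0 \<equiv> J (\<phi>\<^sub>2 0)"
abbreviation p1 where "p1 \<equiv> J (\<phi>\<^sub>1 (Suc 0))"
abbreviation q1 where "q1 \<equiv> J (\<phi>\<^sub>2 (Suc 0))"
abbreviation a1 where "a1 \<equiv> jv (\<phi>\<^sub>1 (Suc 0))"
abbreviation b1 where "b1 \<equiv> jv (\<phi>\<^sub>2 (Suc 0))"
abbreviation p2 where "p2 \<equiv> J (\<phi>\<^sub>1 (Suc (Suc 0)))"
abbreviation q2 where "q2 \<equiv> J (\<phi>\<^sub>2 (Suc (Suc 0)))"
abbreviation a2 where "a2 \<equiv> jv (\<phi>\<^sub>1 (Suc (Suc 0)))"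
abbreviation b2 where "b2 \<equiv> jv (\<phi>\<^sub>2 (Suc (Suc 0)))"
abbreviation p3 where "p3 \<equiv> J (\<phi>\<^sub>1 (Suc (Suc (Suc 0))))"
abbreviation q3 where "q3 \<equiv> J (\<phi>\<^sub>2 (Suc (Suc (Suc 0))))"
abbreviation a3 where "a3 \<equiv> jv (\<phi>\<^sub>1 (Suc (Suc (Suc 0))))"
abbreviation b3 where "b3 \<equiv> jv (\<phi>\<^sub>2 (Suc (Suc (Suc 0))))"
abbreviation p4 where "p4 \<equiv> J (\<phi>\<^sub>1 (Suc (Suc (Suc (Suc 0)))))"
abbreviation q4 where "q4 \<equiv> J (\<phi>\<^sub>2 (Suc (Suc (Suc (Suc 0)))))"
abbreviation a4 where "a4 \<equiv> jv (\<phi>\<^sub>1 (Suc (Suc (Suc (Suc 0)))))"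
abbreviation b4 where "b4 \<equiv> jv (\<phi>\<^sub>2 (Suc (Suc (Suc (Suc 0)))))"
abbreviation p5 where "p5 \<equiv> J (\<phi>\<^sub>1 (Suc (Suc (Suc (Suc (Suc 0))))))"
abbreviation q5 where "q5 \<equiv> J (\<phi>\<^sub>2 (Suc (Suc (Suc (Suc (Suc 0))))))"
abbreviation p6 where "p6 \<equiv> J (\<phi>\<^sub>1 (Suc (Suc (Suc (Suc (Suc (Suc 0)))))))"
abbreviation q6 where "q6 \<equiv> J (\<phi>\<^sub>2 (Suc (Suc (Suc (Suc (Suc (Suc 0)))))))"

text \<open>
  The factor \<open>1/9\<close> of the operator is kept as an indeterminate, so that only integers occur in
  the calculations.
\<close>

definition ninth :: jetfun where "ninth = jconst (1 / 9)"

text \<open>Past the end of the list the value is 0; with lists of length four this gives the local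
  part of the operator order 3.\<close>

primrec nth0 :: "'a::zero list \<Rightarrow> nat \<Rightarrow> 'a" where
  "nth0 [] k = 0"
| "nth0 (x # xs) k = (case k of 0 \<Rightarrow> x | Suc m \<Rightarrow> nth0 xs m)"

text \<open>The two entries of a row have the same factor in front of the inverse of D belonging to
  each gradient. Hence their nonlocal terms combine into the generators \<open>W1\<close> and
  \<open>W2\<close>, each with a single coefficient per row.\<close>

fun R_form :: "component \<Rightarrow> gen \<Rightarrow> jetfun" where
  "R_form C1 (J (\<phi>\<^sub>1 k)) = nth0 [ninth * (- 4*a1*a1*a1 + 15*E1*a1 + 24*E1*b1 - 12*E2*a1 - 3*E2*b1
      - 21*E3*a1 - 39*E3*b1 - 2*a1*a2 - a1*b1*b1 - 7*a1*b2 - 7*a1*a1*b1 - a2*b1 - 2*b1*b2),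
     ninth * (3*E1 + 3*E2 + 21*E3 - a1*a1 + 3*a2 - b1*b1 + 3*b2 - a1*b1),
     ninth * (6*a1 + 6*b1),
     ninth * 3] k"
| "R_form C1 (J (\<phi>\<^sub>2 k)) = nth0 [ninth * (- 2*a1*a1*a1 + 6*E1*a1 + 6*E2*a1 + 36*E2*b1 - 30*E3*a1
    - 36*E3*b1 + 2*a1*a2 - 2*a1*b1*b1 - 2*a1*b2 - 2*a1*a1*b1 - 2*a2*b1 - 4*b1*b2),
     ninth * (6*E1 + 24*E2 + 24*E3 - 2*a1*a1 + 3*a2 - 2*b1*b1 - 2*a1*b1),
     ninth * 6*a1,
     ninth * 6] k"
| "R_form C1 W1 = ninth * (- 3*E2 + 3*E3 - a1*a1 - a2 - 2*b2 - 2*a1*b1)"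
| "R_form C1 W2 = ninth * (- a1)"
| "R_form C2 (J (\<phi>\<^sub>1 k)) = nth0 [ninth * (2*b1*b1*b1 - 36*E1*a1 - 6*E1*b1 - 6*E2*b1 + 36*E3*a1
    + 30*E3*b1 + 4*a1*a2 + 2*a1*b1*b1 + 2*a1*b2 + 2*a1*a1*b1 + 2*a2*b1 - 2*b1*b2),
     ninth * (- 24*E1 - 6*E2 - 24*E3 + 2*a1*a1 + 2*b1*b1 - 3*b2 + 2*a1*b1),
     ninth * (- 6*b1),
     ninth * (- 6)] k"
| "R_form C2 (J (\<phi>\<^sub>2 k)) = nth0 [ninth * (4*b1*b1*b1 + 3*E1*a1 + 12*E1*b1 - 24*E2*a1 - 15*E2*b1
    + 39*E3*a1 + 21*E3*b1 + 2*a1*a2 + 7*a1*b1*b1 + a1*b2 + a1*a1*b1 + 7*a2*b1 + 2*b1*b2),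
     ninth * (- 3*E1 - 3*E2 - 21*E3 + a1*a1 - 3*a2 + b1*b1 - 3*b2 + a1*b1),
     ninth * (- 6*a1 - 6*b1),
     ninth * (- 3)] k"
| "R_form C2 W1 = ninth * (3*E1 - 3*E3 + 2*a2 + b1*b1 + b2 + 2*a1*b1)"
| "R_form C2 W2 = ninth * (- b1)"

definition S11 :: jetfun where "S11 = - 6*E1 + 6*E3 - 2*a2 - b2"

definition S12 :: jetfun where "S12 = - 6*E2 + 6*E3 - a2 - 2*b2"

definition S21 :: jetfun where "S21 = - 3*b3 - 12*E1*b1 - 12*E2*b1 - 12*E3*b1 - 4*a1*a2 - 2*a1*b2
    - 2*a2*b1 + 2*b1*b2"

definition S22 :: jetfun where "S22 = 3*a3 + 12*E1*a1 + 12*E2*a1 + 12*E3*a1 - 2*a1*a2 + 2*a1*b2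
    + 2*a2*b1 + 4*b1*b2"

text \<open>The pairs are variational derivatives. For \<open>W1\<close> the density is
  \<open>a1*a1 + a1*b1 + b1*b1 - 3*(E1 + E2 + E3)\<close>; for \<open>W2\<close> it is
  \<open>-3*a2*b1 + (2/3)*a1^3 + a1^2*b1 - a1*b1^2 - (2/3)*b1^3 + 6*(E2 - E3)*a1 - 6*E1*b1\<close>.
  This is why their Frechet derivatives are self-adjoint.\<close>

fun gradient :: "gen \<Rightarrow> component \<Rightarrow> jetfun" where
  "gradient W1 C1 = S11"
| "gradient W1 C2 = S12"
| "gradient W2 C1 = S21"
| "gradient W2 C2 = S22"
| "gradient (J v) c = 0"

text \<open>
  The coefficients of \<open>\<Sum>\<^sub>g f(g) D(g)\<close>, that is, the part of the derivative of a linear form that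
  comes from the generators.
\<close>

fun shift :: "(gen \<Rightarrow> jetfun) \<Rightarrow> gen \<Rightarrow> jetfun" where
  "shift f (J (\<phi>\<^sub>1 0)) = S11 * f W1 + S21 * f W2"
| "shift f (J (\<phi>\<^sub>2 0)) = S12 * f W1 + S22 * f W2"
| "shift f (J (\<phi>\<^sub>1 (Suc k))) = f (J (\<phi>\<^sub>1 k))"
| "shift f (J (\<phi>\<^sub>2 (Suc k))) = f (J (\<phi>\<^sub>2 k))"
| "shift f W1 = 0"
| "shift f W2 = 0"

definition lin_D :: "(gen \<Rightarrow> jetfun) \<Rightarrow> gen \<Rightarrow> jetfun" where
  "lin_D f g = dt (f g) + shift f g"

definition bil_D :: "(gen \<Rightarrow> gen \<Rightarrow> jetfun) \<Rightarrow> gen \<Rightarrow> gen \<Rightarrow> jetfun" where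
  "bil_D B g h = dt (B g h) + shift (\<lambda>g'. B g' h) g + shift (B g) h"

fun frechet_form :: "jetfun \<Rightarrow> gen \<Rightarrow> jetfun" where
  "frechet_form a (J v) = pd v a"
| "frechet_form a W1 = 0"
| "frechet_form a W2 = 0"

text \<open>Correct only for coefficients of order at most 3.\<close>

definition frechet_R_form :: "jetfun \<Rightarrow> gen \<Rightarrow> jetfun" where
  "frechet_R_form a g = pd (\<phi>\<^sub>1 0) a * R_form C1 g + pd (\<phi>\<^sub>2 0) a * R_form C2 g
   + pd (\<phi>\<^sub>1 (Suc 0)) a * lin_D (R_form C1) g + pd (\<phi>\<^sub>2 (Suc 0)) a * lin_D (R_form C2) g
   + pd (\<phi>\<^sub>1 (Suc (Suc 0))) a * lin_D (lin_D (R_form C1)) g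
       + pd (\<phi>\<^sub>2 (Suc (Suc 0))) a * lin_D (lin_D (R_form C2)) g
   + pd (\<phi>\<^sub>1 (Suc (Suc (Suc 0)))) a * lin_D (lin_D (lin_D (R_form C1))) g
       + pd (\<phi>\<^sub>2 (Suc (Suc (Suc 0)))) a * lin_D (lin_D (lin_D (R_form C2))) g"

primrec table_form :: "(gen \<times> gen \<times> jetfun) list \<Rightarrow> gen \<Rightarrow> gen \<Rightarrow> jetfun" where
  "table_form [] g h = 0"
| "table_form (e # es) g h = (if g = fst e \<and> h = fst (snd e) then snd (snd e) else 0)
    + table_form es g h"

text \<open>
  An entry \<open>(g, h, c)\<close> stands for \<open>c \<cdot> g(P) \<cdot> h(Q)\<close>.  The tables were found by integrating by
  parts; of the resulting antisymmetric forms only one entry of each pair \<open>(g, h)\<close>, \<open>(h, g)\<close> is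
  kept.
\<close>

fun beta :: "gen \<Rightarrow> (gen \<times> gen \<times> jetfun) list" where
  "beta W1 = [(p0, p1, 2),
    (p0, q1, 1),
    (q0, p1, 1),
    (q0, q1, 2)]"
| "beta W2 = [(p0, q0, 12*E1 + 12*E2 + 12*E3),
    (p0, p1, 4*a1 + 2*b1),
    (p0, q1, 2*a1 - 2*b1),
    (p0, q2, 3),
    (q0, p1, 2*a1 - 2*b1),
    (q0, q1, - 2*a1 - 4*b1),
    (q0, p2, - 3),
    (p1, q1, - 3)]"
| "beta (J v) = []"

fun upsilon :: "gen \<Rightarrow> (gen \<times> gen \<times> jetfun) list" where
  "upsilon W1 = [(p0, q0, ninth * (72*E1*E1 + 72*E2*E2 + 72*E3*E3 + 6*a2*a2 + 6*b2*b2 + 252*E1*E2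
      + 252*E1*E3 + 102*E1*a1*a1 + 117*E1*a2 - 24*E1*b1*b1 + 252*E2*E3 - 24*E2*a1*a1 + 102*E2*b1*b1
      + 117*E2*b2 + 102*E3*a1*a1 - 117*E3*a2 + 102*E3*b1*b1 - 117*E3*b2 - 6*a1*a3 - 3*a1*b3
      - 3*a1*a1*b2 - 3*a2*b1*b1 + 6*a2*b2 - 3*a3*b1 - 6*b1*b3 - 24*E1*a1*b1 - 24*E2*a1*b1
      + 228*E3*a1*b1 - 6*a1*a2*b1 - 6*a1*b1*b2)),
    (p0, p1, ninth * (- 8*a1*a1*a1 + 6*a3 + 2*b1*b1*b1 + 3*b3 - 30*E1*a1 + 120*E1*b1 - 48*E2*a1
        - 24*E2*b1 - 30*E3*a1 - 150*E3*b1 - 18*a1*b2 - 12*a1*a1*b1 - 9*b1*b2)),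
    (p0, q1, ninth * (- 4*a1*a1*a1 + 3*a3 + 4*b1*b1*b1 - 3*b3 - 15*E1*a1 + 24*E1*b1 - 24*E2*a1
        + 141*E2*b1 - 15*E3*a1 - 111*E3*b1 + 6*a1*a2 + 3*a1*b1*b1 - 6*a1*b2 - 3*a1*a1*b1 + 3*a2*b1
        - 12*b1*b2)),
    (p0, p2, ninth * (18*E1 - 18*E3 + 18*a2 + 9*b2)),
    (p0, q2, ninth * (81*E1 + 45*E2 + 63*E3 - 3*a1*a1 + 9*a2 - 3*b1*b1 - 9*b2 - 3*a1*b1)),
    (p0, p3, ninth * (12*a1 + 6*b1)),
    (p0, q3, ninth * (6*a1 - 6*b1)),
    (p0, q4, ninth * 9),
    (p0, W1, ninth * (- 3*b3 - 12*E1*b1 - 12*E2*b1 - 12*E3*b1 - 4*a1*a2 - 2*a1*b2 - 2*a2*b1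
        + 2*b1*b2)),
    (p0, W2, ninth * (- 6*E1 + 6*E3 - 2*a2 - b2)),
    (q0, p1, ninth * (- 4*a1*a1*a1 + 3*a3 + 4*b1*b1*b1 - 3*b3 - 141*E1*a1 + 24*E1*b1 - 24*E2*a1
        + 15*E2*b1 + 111*E3*a1 + 15*E3*b1 + 12*a1*a2 + 3*a1*b1*b1 - 3*a1*b2 - 3*a1*a1*b1 + 6*a2*b1
        - 6*b1*b2)),
    (q0, q1, ninth * (- 2*a1*a1*a1 - 3*a3 + 8*b1*b1*b1 - 6*b3 + 24*E1*a1 + 48*E1*b1 - 120*E2*a1
        + 30*E2*b1 + 150*E3*a1 + 30*E3*b1 + 9*a1*a2 + 12*a1*b1*b1 + 18*a2*b1)),
    (q0, p2, ninth * (- 45*E1 - 81*E2 - 63*E3 + 3*a1*a1 + 9*a2 + 3*b1*b1 - 9*b2 + 3*a1*b1)),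
    (q0, q2, ninth * (- 18*E2 + 18*E3 - 9*a2 - 18*b2)),
    (q0, p3, ninth * (6*a1 - 6*b1)),
    (q0, q3, ninth * (- 6*a1 - 12*b1)),
    (q0, p4, ninth * (- 9)),
    (q0, W1, ninth * (3*a3 + 12*E1*a1 + 12*E2*a1 + 12*E3*a1 - 2*a1*a2 + 2*a1*b2 + 2*a2*b1 + 4*b1*b2)),
    (q0, W2, ninth * (- 6*E2 + 6*E3 - a2 - 2*b2)),
    (p1, q1, ninth * (- 63*E1 - 63*E2 - 63*E3 + 3*a1*a1 + 3*b1*b1 + 3*a1*b1)),
    (p1, p2, ninth * (- 12*a1 - 6*b1)),
    (p1, q2, ninth * (- 6*a1 + 6*b1)),
    (p1, q3, ninth * (- 9)),
    (p1, W1, ninth * (- 6*E1 + 12*E2 - 6*E3 + 3*b2)),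
    (q1, p2, ninth * (- 6*a1 + 6*b1)),
    (q1, q2, ninth * (6*a1 + 12*b1)),
    (q1, p3, ninth * 9),
    (q1, W1, ninth * (- 12*E1 + 6*E2 + 6*E3 - 3*a2)),
    (p2, q2, ninth * 9)]"
| "upsilon W2 = [(p0, q0, ninth * (81*E1*a3 + 162*E1*b3 + 144*E1*E1*a1 + 288*E1*E1*b1 - 162*E2*a3
    - 81*E2*b3 - 288*E2*E2*a1 - 144*E2*E2*b1 + 81*E3*a3 - 81*E3*b3 + 144*E3*E3*a1 - 144*E3*E3*b1
    - 9*a1*b4 - 6*a1*a1*a3 - 3*a1*a1*b3 + 6*a1*a1*a1*b2 - 6*a2*b1*b1*b1 + 9*a2*b3 + 3*a3*b1*b1
    - 9*a3*b2 + 9*a4*b1 + 6*b1*b1*b3 - 468*E1*E2*a1 + 468*E1*E2*b1 + 936*E1*E3*a1 + 468*E1*E3*b1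
    + 252*E1*a1*a2 + 306*E1*a1*b2 + 198*E1*a2*b1 - 468*E2*E3*a1 - 936*E2*E3*b1 - 198*E2*a1*b2
    - 306*E2*a2*b1 - 252*E2*b1*b2 - 252*E3*a1*a2 + 54*E3*a1*b2 - 54*E3*a2*b1 + 252*E3*b1*b2
    - 6*a1*a2*b1*b1 - 6*a1*a3*b1 + 6*a1*b1*b3 + 6*a1*b1*b1*b2 - 6*a1*a1*a2*b1 + 6*a1*a1*b1*b2)),
    (p0, p1, ninth * (- 342*E1*E1 - 72*E2*E2 - 342*E3*E3 - 16*a1*a1*a1*a1 + 24*a2*a2 - 4*b1*b1*b1*b1
        - 3*b2*b2 - 9*b4 - 360*E1*E2 - 468*E1*E3 - 1020*E1*a1*a1 - 558*E1*a2 + 258*E1*b1*b1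
        - 171*E1*b2 - 360*E2*E3 + 24*E2*a1*a1 - 30*E2*b1*b1 - 108*E2*b2 - 1020*E3*a1*a1 + 558*E3*a2
        - 1164*E3*b1*b1 + 387*E3*b2 + 60*a1*a3 - 2*a1*b1*b1*b1 + 30*a1*b3 - 18*a1*a1*b1*b1
        - 32*a1*a1*a1*b1 + 6*a2*b1*b1 + 24*a2*b2 + 30*a3*b1 + 24*b1*b3 + 21*b1*b1*b2 + 402*E1*a1*b1
        + 24*E2*a1*b1 - 2442*E3*a1*b1 + 12*a1*a2*b1 + 6*a1*b1*b2)),
    (p0, q1, ninth * (- 36*E1*E1 - 36*E2*E2 - 306*E3*E3 - 8*a1*a1*a1*a1 + 12*a2*a2 - 9*a4
        - 8*b1*b1*b1*b1 + 12*b2*b2 - 9*b4 - 126*E1*E2 - 234*E1*E3 + 102*E1*a1*a1 - 117*E1*a2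
        + 12*E1*b1*b1 - 126*E1*b2 - 234*E2*E3 + 12*E2*a1*a1 - 216*E2*a2 + 12*E2*b1*b1 - 162*E2*b2
        - 1122*E3*a1*a1 + 441*E3*a2 - 1032*E3*b1*b1 + 396*E3*b2 + 30*a1*a3 - 10*a1*b1*b1*b1
        + 15*a1*b3 + 12*a1*a1*a2 + 6*a1*a1*b2 - 10*a1*a1*a1*b1 + 15*a2*b1*b1 + 39*a2*b2 + 51*a3*b1
        + 30*b1*b3 + 30*b1*b1*b2 + 246*E1*a1*b1 + 66*E2*a1*b1 - 2400*E3*a1*b1 + 18*a1*a2*b1
        + 36*a1*b1*b2)),
    (p0, p2, ninth * (- 36*b3 - 288*E1*a1 + 36*E1*b1 - 144*E2*b1 + 288*E3*a1 + 324*E3*b1 + 72*a1*a2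
        + 36*a1*b2 + 36*a2*b1 + 54*b1*b2)),
    (p0, q2, ninth * (- 6*a1*a1*a1 - 36*a3 + 6*b1*b1*b1 - 36*b3 - 9*E1*a1 + 126*E1*b1 - 54*E2*a1
        - 99*E2*b1 + 279*E3*a1 + 189*E3*b1 + 36*a1*a2 + 9*a1*b1*b1 - 9*a1*b2 - 9*a1*a1*b1 + 63*a2*b1
        + 36*b1*b2)),
    (p0, p3, ninth * (- 144*E1 - 90*E2 - 144*E3 + 30*a1*a1 + 30*b1*b1 - 45*b2 + 30*a1*b1)),
    (p0, q3, ninth * (- 45*E1 - 45*E2 - 99*E3 + 15*a1*a1 - 45*a2 + 15*b1*b1 - 45*b2 + 15*a1*b1)),
    (p0, p5, ninth * (- 18)),
    (p0, q5, ninth * (- 9)),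
    (p0, W1, ninth * (6*a4 + 6*b2*b2 + 3*b4 + 48*E1*a1*a1 + 24*E1*a2 - 24*E1*b1*b1 + 12*E1*b2
        + 24*E2*a2 + 12*E2*b2 - 48*E3*a1*a1 + 24*E3*a2 - 48*E3*b1*b1 + 12*E3*b2 - 8*a1*a1*a2
        - 4*a1*a1*b2 - 8*a2*b1*b1 + 12*a2*b2 - 4*b1*b1*b2 - 24*E1*a1*b1 - 120*E3*a1*b1 - 8*a1*a2*b1
        - 4*a1*b1*b2)),
    (p0, W2, ninth * (- 3*b3 - 12*E1*b1 - 12*E2*b1 - 12*E3*b1 - 4*a1*a2 - 2*a1*b2 - 2*a2*b1
        + 2*b1*b2)),
    (q0, p1, ninth * (- 36*E1*E1 - 36*E2*E2 - 306*E3*E3 - 8*a1*a1*a1*a1 + 12*a2*a2 - 9*a4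
        - 8*b1*b1*b1*b1 + 12*b2*b2 - 9*b4 - 126*E1*E2 - 234*E1*E3 + 12*E1*a1*a1 - 162*E1*a2
        + 12*E1*b1*b1 - 216*E1*b2 - 234*E2*E3 + 12*E2*a1*a1 - 126*E2*a2 + 102*E2*b1*b1 - 117*E2*b2
        - 1032*E3*a1*a1 + 396*E3*a2 - 1122*E3*b1*b1 + 441*E3*b2 + 30*a1*a3 - 10*a1*b1*b1*b1
        + 51*a1*b3 + 30*a1*a1*a2 + 15*a1*a1*b2 - 10*a1*a1*a1*b1 + 6*a2*b1*b1 + 39*a2*b2 + 15*a3*b1
        + 30*b1*b3 + 12*b1*b1*b2 + 66*E1*a1*b1 + 246*E2*a1*b1 - 2400*E3*a1*b1 + 36*a1*a2*b1
        + 18*a1*b1*b2)),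
    (q0, q1, ninth * (- 72*E1*E1 - 342*E2*E2 - 342*E3*E3 - 4*a1*a1*a1*a1 - 3*a2*a2 - 9*a4
        - 16*b1*b1*b1*b1 + 24*b2*b2 - 360*E1*E2 - 360*E1*E3 - 30*E1*a1*a1 - 108*E1*a2 + 24*E1*b1*b1
        - 468*E2*E3 + 258*E2*a1*a1 - 171*E2*a2 - 1020*E2*b1*b1 - 558*E2*b2 - 1164*E3*a1*a1
        + 387*E3*a2 - 1020*E3*b1*b1 + 558*E3*b2 + 24*a1*a3 - 32*a1*b1*b1*b1 + 30*a1*b3 + 21*a1*a1*a2
        - 18*a1*a1*b1*b1 + 6*a1*a1*b2 - 2*a1*a1*a1*b1 + 24*a2*b2 + 30*a3*b1 + 60*b1*b3 + 24*E1*a1*b1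
        + 402*E2*a1*b1 - 2442*E3*a1*b1 + 6*a1*a2*b1 + 12*a1*b1*b2)),
    (q0, p2, ninth * (6*a1*a1*a1 - 36*a3 - 6*b1*b1*b1 - 36*b3 - 99*E1*a1 - 54*E1*b1 + 126*E2*a1
        - 9*E2*b1 + 189*E3*a1 + 279*E3*b1 + 36*a1*a2 - 9*a1*b1*b1 + 63*a1*b2 + 9*a1*a1*b1 - 9*a2*b1
        + 36*b1*b2)),
    (q0, q2, ninth * (- 36*a3 - 144*E1*a1 + 36*E2*a1 - 288*E2*b1 + 324*E3*a1 + 288*E3*b1 + 54*a1*a2
        + 36*a1*b2 + 36*a2*b1 + 72*b1*b2)),
    (q0, p3, ninth * (- 45*E1 - 45*E2 - 99*E3 + 15*a1*a1 - 45*a2 + 15*b1*b1 - 45*b2 + 15*a1*b1)),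
    (q0, q3, ninth * (- 90*E1 - 144*E2 - 144*E3 + 30*a1*a1 - 45*a2 + 30*b1*b1 + 30*a1*b1)),
    (q0, p5, ninth * (- 9)),
    (q0, q5, ninth * (- 18)),
    (q0, W1, ninth * (6*a2*a2 + 3*a4 + 6*b4 + 12*E1*a2 + 24*E1*b2 - 24*E2*a1*a1 + 12*E2*a2
        + 48*E2*b1*b1 + 24*E2*b2 - 48*E3*a1*a1 + 12*E3*a2 - 48*E3*b1*b1 + 24*E3*b2 - 4*a1*a1*a2
        - 8*a1*a1*b2 - 4*a2*b1*b1 + 12*a2*b2 - 8*b1*b1*b2 - 24*E2*a1*b1 - 120*E3*a1*b1 - 4*a1*a2*b1
        - 8*a1*b1*b2)),
    (q0, W2, ninth * (3*a3 + 12*E1*a1 + 12*E2*a1 + 12*E3*a1 - 2*a1*a2 + 2*a1*b2 + 2*a2*b1 + 4*b1*b2)),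
    (p1, q1, ninth * (6*a1*a1*a1 - 6*b1*b1*b1 - 45*E1*a1 - 90*E1*b1 + 90*E2*a1 + 45*E2*b1 - 45*E3*a1
        + 45*E3*b1 - 9*a1*b1*b1 + 36*a1*b2 + 9*a1*a1*b1 - 36*a2*b1)),
    (p1, p2, ninth * (144*E1 + 90*E2 + 144*E3 - 30*a1*a1 - 30*b1*b1 + 45*b2 - 30*a1*b1)),
    (p1, q2, ninth * (45*E1 + 45*E2 + 99*E3 - 15*a1*a1 + 45*a2 - 15*b1*b1 + 45*b2 - 15*a1*b1)),
    (p1, p4, ninth * 18),
    (p1, q4, ninth * 9),
    (p1, W1, ninth * (- 6*a3 - 3*b3 - 24*E1*a1 - 12*E1*b1 - 24*E2*a1 - 12*E2*b1 - 24*E3*a1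
        - 12*E3*b1 - 6*a1*b2 - 6*a2*b1 - 6*b1*b2)),
    (q1, p2, ninth * (45*E1 + 45*E2 + 99*E3 - 15*a1*a1 + 45*a2 - 15*b1*b1 + 45*b2 - 15*a1*b1)),
    (q1, q2, ninth * (90*E1 + 144*E2 + 144*E3 - 30*a1*a1 + 45*a2 - 30*b1*b1 - 30*a1*b1)),
    (q1, p4, ninth * 9),
    (q1, q4, ninth * 18),
    (q1, W1, ninth * (- 3*a3 - 6*b3 - 12*E1*a1 - 24*E1*b1 - 12*E2*a1 - 24*E2*b1 - 12*E3*a1
        - 24*E3*b1 - 6*a1*a2 - 6*a1*b2 - 6*a2*b1)),
    (p2, p3, ninth * (- 18)),
    (p2, q3, ninth * (- 9)),
    (q2, p3, ninth * (- 9)),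
    (q2, q3, ninth * (- 18))]"
| "upsilon (J v) = []"

text \<open>
  The form of \<open>R'[P] Q\<close> with \<open>D\<^sup>-\<^sup>1 (D\<^bsub>s\<^sub>l\<^esub>[P] \<cdot> Q)\<close> replaced by \<open>\<beta>\<^sub>l\<close>, which changes it by a term
  symmetric in \<open>P\<close> and \<open>Q\<close>.
\<close>

definition dR_form :: "component \<Rightarrow> gen \<Rightarrow> gen \<Rightarrow> jetfun" where
  "dR_form i g h = frechet_form (R_form i h) g + R_form i W1 * table_form (beta W1) g h
      + R_form i W2 * table_form (beta W2) g h"

fun pairing :: "(gen \<Rightarrow> jetfun) \<Rightarrow> (gen \<Rightarrow> jetfun) \<Rightarrow> gen \<Rightarrow> gen \<Rightarrow> jetfun" where
  "pairing f f' g (J (\<phi>\<^sub>1 0)) = f g"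
| "pairing f f' g (J (\<phi>\<^sub>2 0)) = f' g"
| "pairing f f' g (J (\<phi>\<^sub>1 (Suc k))) = 0"
| "pairing f f' g (J (\<phi>\<^sub>2 (Suc k))) = 0"
| "pairing f f' g W1 = 0"
| "pairing f f' g W2 = 0"

text \<open>By self-adjointness, D_s[P].Q - D_s[Q].P is the total derivative of the antisymmetric
  form recorded in \<open>beta\<close>. Subtracting \<open>bil_D\<close> of the table therefore
  leaves a symmetric form.\<close>

definition beta_defect :: "gen \<Rightarrow> gen \<Rightarrow> gen \<Rightarrow> jetfun" where
  "beta_defect l g h = pairing (frechet_form (gradient l C1)) (frechet_form (gradient l C2)) g h
      - bil_D (table_form (beta l)) g h"

text \<open>Let t = R^* s_l be the next gradient. Modulo total derivatives, self-adjointness of the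
  Frechet derivative of s_l turns X_l(P,Q) - X_l(Q,P) into D_t[Q].P - D_t[P].Q. Symmetry of this
  defect thus expresses the self-adjointness of D_t, with an explicit primitive.\<close>

definition upsilon_defect :: "gen \<Rightarrow> gen \<Rightarrow> gen \<Rightarrow> jetfun" where
  "upsilon_defect l g h
      = pairing (frechet_R_form (gradient l C1)) (frechet_R_form (gradient l C2)) g h
    - (gradient l C1 * dR_form C1 g h + gradient l C2 * dR_form C2 g h)
        - bil_D (table_form (upsilon l)) g h"

text \<open>This is R'[R P] Q - R R'[P] Q with every inverse of D on a bilinear expression replaced
  by an explicit form. The inverses in the first term and those in the outer R have the same
  prefactors \<open>R_form i W1\<close> and \<open>R_form i W2\<close>, so they act on one combined
  integrand X_l; hence each \<open>upsilon\<close> table occurs once, with a plus sign.\<close>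

definition torsion_form :: "component \<Rightarrow> gen \<Rightarrow> gen \<Rightarrow> jetfun" where
  "torsion_form i g h = frechet_R_form (R_form i h) g
   - (R_form i p0 * dR_form C1 g h + R_form i q0 * dR_form C2 g h
    + R_form i p1 * bil_D (dR_form C1) g h + R_form i q1 * bil_D (dR_form C2) g h
    + R_form i p2 * bil_D (bil_D (dR_form C1)) g h + R_form i q2 * bil_D (bil_D (dR_form C2)) g h
    + R_form i p3 * bil_D (bil_D (bil_D (dR_form C1))) g h
        + R_form i q3 * bil_D (bil_D (bil_D (dR_form C2))) g h)
   + R_form i W1 * table_form (upsilon W1) g h + R_form i W2 * table_form (upsilon W2) g h"

section \<open>Rewrite rules for symbolic differentiation, and orders of the coefficients\<close>

lemma ninth_rules: "dt ninth = 0" "pd v ninth = 0" "swp ninth = ninth"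
  by (simp_all add: ninth_def dt_rules pd_rules swp_rules)

lemma dt_atoms: "dt (jv (\<phi>\<^sub>1 k)) = jv (\<phi>\<^sub>1 (Suc k))" "dt (jv (\<phi>\<^sub>2 k)) = jv (\<phi>\<^sub>2 (Suc k))"
  "dt E1 = 2 * a1 * E1"  "dt E2 = 2 * b1 * E2" "dt E3 = - 2 * (a1 + b1) * E3"
  by (simp_all add: dt_rules)

text \<open>The conditions of \<open>pd_simps\<close> are split by constructors, so that
  \<open>simp only\<close> can decide them without arithmetic on orders.\<close>

lemma pd_atoms: "pd (\<phi>\<^sub>1 k) (jv (\<phi>\<^sub>1 l)) = (if k = l then 1 else 0)"
    "pd (\<phi>\<^sub>2 k) (jv (\<phi>\<^sub>2 l)) = (if k = l then 1 else 0)"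
 "pd (\<phi>\<^sub>1 k) (jv (\<phi>\<^sub>2 l)) = 0" "pd (\<phi>\<^sub>2 k) (jv (\<phi>\<^sub>1 l)) = 0"
 "pd (\<phi>\<^sub>1 0) E1 = 2 * E1" "pd (\<phi>\<^sub>1 (Suc k)) E1 = 0"  "pd (\<phi>\<^sub>2 k) E1 = 0"
 "pd (\<phi>\<^sub>2 0) E2 = 2 * E2" "pd (\<phi>\<^sub>2 (Suc k)) E2 = 0"  "pd (\<phi>\<^sub>1 k) E2 = 0"
 "pd (\<phi>\<^sub>1 0) E3 = - 2 * E3" "pd (\<phi>\<^sub>1 (Suc k)) E3 = 0"
 "pd (\<phi>\<^sub>2 0) E3 = - 2 * E3" "pd (\<phi>\<^sub>2 (Suc k)) E3 = 0"
  by (simp_all add: pd_rules)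

lemmas arith_rules = add_0_left add_0_right mult_zero_left mult_zero_right mult_1_left mult_1_right
  diff_zero diff_0 minus_zero diff_self if_True if_False

lemmas deriv_rules = dt_simps(1-5) dt_numeral dt_uminus dt_minus dt_atoms ninth_rules
  pd_simps(1-5) pd_numeral pd_uminus pd_minus pd_atoms

lemmas constructor_rules
    = nat.distinct nat.inject gen.distinct gen.inject jvar.distinct jvar.inject simp_thms fst_conv
    snd_conv

lemmas form_defs
    = torsion_form_def upsilon_defect_def beta_defect_def pairing.simps dR_form_def
    frechet_form.simps frechet_R_form_def bil_D_def lin_D_def shift.simps table_form.simps
    beta.simps upsilon.simps R_form.simps nth0.simps nat.case S11_def S12_def S21_def S22_def
    gradient.simps

lemma gen_exhaust:
  obtains "g = p0" | "g = q0" | k where "g = J (\<phi>\<^sub>1 (Suc k))" | k where "g = J (\<phi>\<^sub>2 (Suc k))"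
  | "g = W1" | "g = W2"
proof (cases g)
  case (J v)
  obtain k where "v = \<phi>\<^sub>1 k \<or> v = \<phi>\<^sub>2 k" by (cases v) auto
  with J that show ?thesis by (cases k) auto
qed (use that in auto)

lemma shift_linear:
  "shift (\<lambda>g. f g + f' g) g = shift f g + shift f' g"
  "shift (\<lambda>g. c * f g) g = c * shift f g"
  "shift (\<lambda>g. f g * c) g = shift f g * c"
  by (rule gen_exhaust[of g]; simp add: algebra_simps)+

abbreviation gens3 :: "gen list" where
  "gens3 \<equiv> [p0, p1, p2, p3, q0, q1, q2, q3, W1, W2]"

fun jet_order :: "jvar \<Rightarrow> nat" where
  "jet_order (\<phi>\<^sub>1 k) = k"
| "jet_order (\<phi>\<^sub>2 k) = k"

text \<open>The nonlocal generators count as order 0: D sends them to combinations of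
  \<open>p0\<close> and \<open>q0\<close>, so differentiation raises the order by at most
  one.\<close>

fun gen_order :: "gen \<Rightarrow> nat" where
  "gen_order (J v) = jet_order v"
| "gen_order W1 = 0"
| "gen_order W2 = 0"

lemma nat_cases4:
  obtains "k = 0" | "k = Suc 0" | "k = Suc (Suc 0)" | "k = Suc (Suc (Suc 0))"
  | m where "k = Suc (Suc (Suc (Suc m)))"
  by (metis not0_implies_Suc)

lemma gen_cases4:
  obtains "g \<in> set gens3" | k where "g = J (\<phi>\<^sub>1 (Suc (Suc (Suc (Suc k)))))"
  | k where "g = J (\<phi>\<^sub>2 (Suc (Suc (Suc (Suc k)))))"
proof (cases g)
  case (J v)
  obtain k where v: "v = \<phi>\<^sub>1 k \<or> v = \<phi>\<^sub>2 k" by (cases v) auto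
  show ?thesis
    by (rule nat_cases4[of k]) (use v J that in auto)
qed (use that in auto)

lemma R_form_outside: "g \<notin> set gens3 \<Longrightarrow> R_form i g = 0"
  by (rule gen_cases4[of g]; cases i; simp)

text \<open>\<open>frechet_R_form\<close> stops at the third derivatives; for coefficients of this
  kind nothing is cut off.\<close>

definition order_le3 :: "jetfun \<Rightarrow> bool" where
  "order_le3 a \<longleftrightarrow> (\<forall>v. 3 < jet_order v \<longrightarrow> pd v a = 0)"

lemma order_le3_rules:
  "order_le3 0" "order_le3 ninth" "order_le3 (numeral n)"
  "order_le3 a \<Longrightarrow> order_le3 b \<Longrightarrow> order_le3 (a + b)"
  "order_le3 a \<Longrightarrow> order_le3 b \<Longrightarrow> order_le3 (a - b)"
  "order_le3 a \<Longrightarrow> order_le3 b \<Longrightarrow> order_le3 (a * b)"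
  "order_le3 a \<Longrightarrow> order_le3 (- a)"
  "order_le3 a1" "order_le3 a2" "order_le3 a3" "order_le3 b1" "order_le3 b2" "order_le3 b3"
  "order_le3 E1" "order_le3 E2" "order_le3 E3"
  by (auto simp: order_le3_def pd_rules ninth_rules)

lemma order_le3_nth0: "\<forall>a\<in>set as. order_le3 a \<Longrightarrow> order_le3 (nth0 as k)"
  by (induction as arbitrary: k) (auto simp: order_le3_rules split: nat.split)

lemma order_le3_R_form: "order_le3 (R_form i g)"
proof -
  have "order_le3 (R_form i (J v))" for v
    by (cases i; cases v; simp only: R_form.simps; rule order_le3_nth0;
        simp only: list.set ball_simps simp_thms order_le3_rules)
  moreover have "order_le3 (R_form i W1)" "order_le3 (R_form i W2)"
    by (cases i; simp only: R_form.simps order_le3_rules)+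
  ultimately show ?thesis by (cases g) auto
qed

lemma order_le3_gradient: "order_le3 (gradient l c)"
  by (cases l; cases c; simp only: gradient.simps S11_def S12_def S21_def S22_def order_le3_rules)

section \<open>The operator entries with coefficients in the ring\<close>

lemmas pdo_defs = plus_pdo_def one_pdo_def times_pdo_def uminus_pdo_def minus_pdo_def

lemma coeff_one: "(\<lambda>u. 1) = fn 1" "(\<lambda>u. -1) = fn (- 1)"
  by (simp_all add: fn_simps fun_eq_iff)

lemma fn_ninth: "fn ninth u = 1/9"
  by (simp add: ninth_def fn_simps)

text \<open>
  Operator expressions obey no algebraic laws, so the sign of the first term of order zero needs
  two shapes, one for \<^const>\<open>R12\<close> and one for \<^const>\<open>R11\<close>.
\<close>

definition op_plus :: "jetfun \<Rightarrow> jetfun \<Rightarrow> jetfun \<Rightarrow> jetfun \<Rightarrow> jetfun \<Rightarrow> jetfun \<Rightarrow> jetfun \<Rightarrow> jetfun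
    \<Rightarrow> jetfun \<Rightarrow> jetfun \<Rightarrow> pdo" where
  "op_plus c3 c2 c1 c0 c0' c0'' A2 s2 A1 s1 =
     Coeff (fn c3) * Dx ^ 3 + Coeff (fn c2) * Dx ^ 2 + Coeff (fn c1) * Dx
   + Coeff (fn c0) + Coeff (fn c0') + Coeff (fn c0'')
   - Coeff (fn A2) * Dx_inv * Coeff (fn s2) - Coeff (fn A1) * Dx_inv * Coeff (fn s1)"

definition op_minus :: "jetfun \<Rightarrow> jetfun \<Rightarrow> jetfun \<Rightarrow> jetfun \<Rightarrow> jetfun \<Rightarrow> jetfun \<Rightarrow> jetfun \<Rightarrow> jetfun
    \<Rightarrow> jetfun \<Rightarrow> jetfun \<Rightarrow> pdo" where
  "op_minus c3 c2 c1 c0 c0' c0'' A2 s2 A1 s1 =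
     Coeff (fn c3) * Dx ^ 3 + Coeff (fn c2) * Dx ^ 2 + Coeff (fn c1) * Dx
   - Coeff (fn c0) + Coeff (fn c0') + Coeff (fn c0'')
   - Coeff (fn A2) * Dx_inv * Coeff (fn s2) - Coeff (fn A1) * Dx_inv * Coeff (fn s1)"

lemma swap_ops:
  "pdo_swap (op_plus c3 c2 c1 c0 c0' c0'' A2 s2 A1 s1) =
     op_plus (swp c3) (swp c2) (swp c1) (swp c0) (swp c0') (swp c0'') (swp A2) (swp s2) (swp A1)
         (swp s1)"
  "pdo_swap (op_minus c3 c2 c1 c0 c0' c0'' A2 s2 A1 s1) =
     op_minus (swp c3) (swp c2) (swp c1) (swp c0) (swp c0') (swp c0'') (swp A2) (swp s2) (swp A1)
         (swp s1)"
  by (simp_all add: op_plus_def op_minus_def pdo_defs numeral_3_eq_3 numeral_2_eq_2 swp.rep_eq)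

lemmas coeff_eqs
    = fn_simps fn_ninth S11_def S12_def S21_def S22_def K1_def s11_def s12_def s21_def s22_def

definition K1_poly :: jetfun where
  "K1_poly = a2 + 2 * b2 + 2 * a1 * b1 + a1 * a1 + 3 * E2 - 3 * E3"

text \<open>An equality of expression trees, not merely of actions: the shape has to agree exactly
  and only the coefficient functions are rewritten.\<close>

lemma R11_eq: "R11 = op_minus (ninth * 3) (ninth * (6 * a1 + 6 * b1))
    (ninth * (3 * a2 - a1 * b1 + 3 * b2 - a1 * a1 - b1 * b1 + 21 * E3 + 3 * E2 + 3 * E1))
    (ninth * (7 * a1 * b2 + a2 * b1 + 2 * a1 * a2 + 2 * b1 * b2 + 4 * a1 * a1 * a1
        + 7 * a1 * a1 * b1 + a1 * b1 * b1))
    (ninth * (3 * (5 * E1 - 4 * E2 - 7 * E3) * a1)) (ninth * (3 * (8 * E1 - E2 - 13 * E3) * b1))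
    (ninth * a1) S21 (ninth * K1_poly) S11"
  by (simp add: R11_def op_minus_def pdo_defs fun_eq_iff coeff_eqs K1_poly_def eval_nat_numeral
      algebra_simps)

lemma R12_eq: "R12 = op_plus (ninth * 6) (ninth * (6 * a1))
    (ninth * (3 * a2 - 2 * a1 * a1 - 2 * a1 * b1 - 2 * b1 * b1 + 6 * E1 + 24 * E2 + 24 * E3))
    (ninth * 2 * (a1 * a2 - a1 * b2 - b1 * a2 - 2 * b1 * b2 - a1 * a1 * a1 - a1 * a1 * b1
        - a1 * b1 * b1))
    (ninth * (6 * (E1 + E2 - 5 * E3) * a1)) (ninth * (36 * (E2 - E3) * b1))
    (ninth * a1) S22 (ninth * K1_poly) S12"
  by (simp add: R12_def op_plus_def pdo_defs fun_eq_iff coeff_eqs K1_poly_def eval_nat_numeral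
      algebra_simps)

section \<open>Reduction of symmetry to finitely many entries\<close>

abbreviation gens6 :: "gen list" where
  "gens6 \<equiv> [p0, q0, p1, q1, p2, q2, p3, q3, p4, q4, p5, q5, p6, q6, W1, W2]"

text \<open>Each unordered pair of distinct generators is checked once. The condition is put in
  terms of real values at a jet so that it becomes a polynomial identity over the reals.\<close>

primrec sym_on :: "gen list \<Rightarrow> (gen \<Rightarrow> gen \<Rightarrow> jetfun) \<Rightarrow> bool" where
  "sym_on [] B \<longleftrightarrow> True"
| "sym_on (g # gs) B \<longleftrightarrow> (\<forall>h\<in>set gs. \<forall>u. fn (B g h - B h g) u = 0) \<and> sym_on gs B"

lemma sym_onD: "sym_on gs B \<Longrightarrow> g \<in> set gs \<Longrightarrow> h \<in> set gs \<Longrightarrow> B g h = B h g"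
proof (induction gs)
  case (Cons a gs)
  have "B a b = B b a" if "b \<in> set gs" for b
    using Cons.prems(1) that by (intro jetfun_eqI) (simp add: fn_simps)
  with Cons show ?case by auto
qed simp

definition supp1 :: "nat \<Rightarrow> (gen \<Rightarrow> jetfun) \<Rightarrow> bool" where
  "supp1 N f \<longleftrightarrow> (\<forall>g. N < gen_order g \<longrightarrow> f g = 0)"

definition supp2 :: "nat \<Rightarrow> (gen \<Rightarrow> gen \<Rightarrow> jetfun) \<Rightarrow> bool" where
  "supp2 N B \<longleftrightarrow> (\<forall>g h. N < gen_order g \<or> N < gen_order h \<longrightarrow> B g h = 0)"

lemma gens6: "gen_order g \<le> 6 \<Longrightarrow> g \<in> set gens6"
proof (cases g)
  case (J v)
  assume "gen_order g \<le> 6"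
  then have "jet_order v \<in> {0, 1, 2, 3, 4, 5, 6}" using J by auto
  then show ?thesis using J by (cases v) (auto simp: eval_nat_numeral)
qed auto

lemma sym_if_sym_on:
  assumes "supp2 6 B" "sym_on gens6 B"
  shows "B g h = B h g"
proof (cases "6 < gen_order g \<or> 6 < gen_order h")
  case True
  with assms(1) show ?thesis unfolding supp2_def by metis
next
  case False
  with sym_onD[OF assms(2) gens6 gens6] show ?thesis by simp
qed

lemma shift_supp1: "supp1 N f \<Longrightarrow> Suc N < gen_order g \<Longrightarrow> shift f g = 0"
  unfolding supp1_def by (rule gen_exhaust[of g]) simp_all

lemma supp1_lin_D: "supp1 N f \<Longrightarrow> supp1 (Suc N) (lin_D f)"
  using shift_supp1[of N f] by (simp add: supp1_def lin_D_def dt_rules)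

lemma shift_zero: "(\<And>g. f g = 0) \<Longrightarrow> shift f g = 0"
  by (rule gen_exhaust[of g]) simp_all

lemma supp2_bil_D:
  assumes "supp2 N B"
  shows "supp2 (Suc N) (bil_D B)"
  unfolding supp2_def
proof (intro allI impI)
  fix g h
  assume gh: "Suc N < gen_order g \<or> Suc N < gen_order h"
  have z: "B g h = 0" if "N < gen_order g \<or> N < gen_order h" for g h
    using assms that unfolding supp2_def by blast
  have "shift (\<lambda>g'. B g' h) g = 0"
    using gh shift_supp1[of N "\<lambda>g'. B g' h" g] shift_zero[of "\<lambda>g'. B g' h" g] z
        by (auto simp: supp1_def)
  moreover have "shift (B g) h = 0"
    using gh shift_supp1[of N "B g" h] shift_zero[of "B g" h] z by (auto simp: supp1_def)
  moreover have "B g h = 0"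
    using gh z by auto
  ultimately show "bil_D B g h = 0"
    by (simp add: bil_D_def dt_rules)
qed

lemma supp1_R_form: "supp1 3 (R_form i)"
proof -
  have "gen_order g \<le> 3" if "g \<in> set gens3" for g using that by auto
  then show ?thesis unfolding supp1_def using R_form_outside linorder_not_less by blast
qed

lemma supp1_frechet_form: "order_le3 a \<Longrightarrow> supp1 3 (frechet_form a)"
  unfolding supp1_def
proof (intro allI impI)
  show "frechet_form a g = 0" if "order_le3 a" "3 < gen_order g" for g
    using that by (cases g) (simp_all add: order_le3_def)
qed

text \<open>The bound 6 arises here: \<open>R_form\<close> has order 3 and is differentiated at most
  three more times.\<close>

lemma supp1_frechet_R_form: "supp1 6 (frechet_R_form a)"
proof -
  note s = supp1_R_form supp1_lin_D[OF supp1_R_form] supp1_lin_D[OF supp1_lin_D[OF supp1_R_form]]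
    supp1_lin_D[OF supp1_lin_D[OF supp1_lin_D[OF supp1_R_form]]]
  show ?thesis
    using s[of C1] s[of C2] by (simp add: supp1_def frechet_R_form_def)
qed

lemma supp2_table_form: "\<forall>e\<in>set es. gen_order (fst e) \<le> N \<and> gen_order (fst (snd e)) \<le> N
    \<Longrightarrow> supp2 N (table_form es)"
  by (induction es) (auto simp: supp2_def)

lemma supp2_mono: "supp2 N B \<Longrightarrow> N \<le> M \<Longrightarrow> supp2 M B"
  by (auto simp: supp2_def)

lemma supp2_beta: "supp2 3 (table_form (beta l))"
  by (rule supp2_table_form) (cases l; simp)

lemma supp2_upsilon: "supp2 5 (table_form (upsilon l))"
  by (rule supp2_table_form) (cases l; simp)

lemma supp2_dR_form: "supp2 3 (dR_form i)"
proof -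
  have "frechet_form (R_form i h) g = 0" if "3 < gen_order g \<or> 3 < gen_order h" for g h
  proof -
    have "frechet_form 0 g = 0" by (cases g) (simp_all add: pd_rules)
    then show ?thesis
      using that supp1_frechet_form[OF order_le3_R_form[of i h]] supp1_R_form[of i]
          by (auto simp: supp1_def)
  qed
  then show ?thesis
    using supp2_beta[of W1] supp2_beta[of W2] by (simp add: supp2_def dR_form_def)
qed

lemma supp2_pairing:
  assumes "supp1 6 f" "supp1 6 f'"
  shows "supp2 6 (pairing f f')"
  unfolding supp2_def
proof (intro allI impI)
  fix g h
  assume "6 < gen_order g \<or> 6 < gen_order h"
  then show "pairing f f' g h = 0"
    using assms unfolding supp1_def by (cases h rule: gen_exhaust) auto
qed

lemma supp2_beta_defect: "supp2 6 (beta_defect l)"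
proof -
  have "supp1 6 (frechet_form (gradient l c))" for c
    using supp1_frechet_form[OF order_le3_gradient[of l c]] by (auto simp: supp1_def)
  note p = supp2_pairing[OF this this, of C1 C2]
  note q = supp2_mono[OF supp2_bil_D[OF supp2_beta[of l]], of 6]
  show ?thesis using p q by (simp add: supp2_def beta_defect_def)
qed

lemma supp2_upsilon_defect: "supp2 6 (upsilon_defect l)"
proof -
  note p = supp2_pairing[OF supp1_frechet_R_form supp1_frechet_R_form, of "gradient l C1"
      "gradient l C2"]
  note q = supp2_mono[OF supp2_bil_D[OF supp2_upsilon[of l]], of 6]
  note r = supp2_mono[OF supp2_dR_form[of C1], of 6] supp2_mono[OF supp2_dR_form[of C2], of 6]
  show ?thesis using p q r by (simp add: supp2_def upsilon_defect_def)
qed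

lemma supp2_torsion_form: "supp2 6 (torsion_form i)"
proof -
  have "frechet_R_form (R_form i h) g = 0" if "6 < gen_order g \<or> 6 < gen_order h" for g h
    using that supp1_frechet_R_form[of "R_form i h"] supp1_R_form[of i]
        by (auto simp: supp1_def frechet_R_form_def pd_rules)
  note p = this
  have u: "supp2 6 (table_form (upsilon l))" for l
    by (rule supp2_mono[OF supp2_upsilon]) simp
  have r: "supp2 6 (dR_form j)" "supp2 6 (bil_D (dR_form j))" "supp2 6 (bil_D (bil_D (dR_form j)))"
    "supp2 6 (bil_D (bil_D (bil_D (dR_form j))))" for j
    by (rule supp2_mono, (rule supp2_bil_D)?, (rule supp2_bil_D)?, (rule supp2_bil_D)?, rule
        supp2_dR_form, simp)+
  show ?thesis
    unfolding supp2_def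
  proof (intro allI impI)
    fix g h
    assume gh: "6 < gen_order g \<or> 6 < gen_order h"
    have "dR_form j g h = 0" "bil_D (dR_form j) g h = 0" "bil_D (bil_D (dR_form j)) g h = 0"
      "bil_D (bil_D (bil_D (dR_form j))) g h = 0" for j
      using r[of j] gh unfolding supp2_def by blast+
    moreover have "table_form (upsilon W1) g h = 0" "table_form (upsilon W2) g h = 0"
      using u[of W1] u[of W2] gh unfolding supp2_def by blast+
    ultimately show "torsion_form i g h = 0"
      by (simp only: torsion_form_def p[OF gh] mult_zero_right add_0_left diff_self)
  qed
qed

section \<open>The finite polynomial verification\<close>

lemma sym_on_beta_defect_W1: "sym_on gens6 (beta_defect W1)"
  unfolding sym_on.simps list.set ball_simps simp_thms
  \<comment> \<open>The first simplification unfolds the forms and carries out the derivations; the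
    second passes to real arithmetic. Since \<open>fn_simps(1-8)\<close> omits the values of the
    atoms, \<open>algebra\<close> sees the jet coordinates, \<open>E1\<close>, \<open>E2\<close>,
    \<open>E3\<close> and \<open>ninth\<close> as independent unknowns. An entry may already be
    closed by simplification, hence the question mark.\<close>
  by (intro conjI allI; simp only: form_defs constructor_rules deriv_rules arith_rules;
      simp only: fn_simps(1-8); algebra?)

lemma sym_on_beta_defect_W2: "sym_on gens6 (beta_defect W2)"
  unfolding sym_on.simps list.set ball_simps simp_thms
  by (intro conjI allI; simp only: form_defs constructor_rules deriv_rules arith_rules;
      simp only: fn_simps(1-8); algebra?)

lemma sym_on_upsilon_defect_W1: "sym_on gens6 (upsilon_defect W1)"
  unfolding sym_on.simps list.set ball_simps simp_thms
  by (intro conjI allI; simp only: form_defs constructor_rules deriv_rules arith_rules;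
      simp only: fn_simps(1-8); algebra?)

lemma sym_on_upsilon_defect_W2: "sym_on gens6 (upsilon_defect W2)"
  unfolding sym_on.simps list.set ball_simps simp_thms
  by (intro conjI allI; simp only: form_defs constructor_rules deriv_rules arith_rules;
      simp only: fn_simps(1-8); algebra?)

lemma sym_on_torsion_form_C1: "sym_on gens6 (torsion_form C1)"
  unfolding sym_on.simps list.set ball_simps simp_thms
  by (intro conjI allI; simp only: form_defs constructor_rules deriv_rules arith_rules;
      simp only: fn_simps(1-8); algebra?)

lemma sym_on_torsion_form_C2: "sym_on gens6 (torsion_form C2)"
  unfolding sym_on.simps list.set ball_simps simp_thms
  by (intro conjI allI; simp only: form_defs constructor_rules deriv_rules arith_rules;
      simp only: fn_simps(1-8); algebra?)

lemma beta_defect_symmetric: "l \<in> {W1, W2} \<Longrightarrow> beta_defect l g h = beta_defect l h g"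
  using sym_on_beta_defect_W1 sym_on_beta_defect_W2
      by (intro sym_if_sym_on[OF supp2_beta_defect]) auto

lemma upsilon_defect_symmetric: "l \<in> {W1, W2} \<Longrightarrow> upsilon_defect l g h = upsilon_defect l h g"
  using sym_on_upsilon_defect_W1 sym_on_upsilon_defect_W2
      by (intro sym_if_sym_on[OF supp2_upsilon_defect]) auto

lemma torsion_form_symmetric: "torsion_form i g h = torsion_form i h g"
  using sym_on_torsion_form_C1 sym_on_torsion_form_C2
      by (intro sym_if_sym_on[OF supp2_torsion_form], cases i) auto

section \<open>Forms with values in a nonlocal extension\<close>

context nonlocal_extension
begin

abbreviation Dinv :: "'m \<Rightarrow> 'm" where
  "Dinv \<equiv> inv_into UNIV D"

definition scale :: "jetfun \<Rightarrow> 'm \<Rightarrow> 'm" (infixr "\<triangleright>" 75) where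
  "a \<triangleright> m = act (fn a) m"

lemma fn_ext: "fn (a + b) = (\<lambda>u. fn a u + fn b u)" "fn (a * b) = (\<lambda>u. fn a u * fn b u)"
  "fn 1 = (\<lambda>u. 1)"
  by (simp_all add: fn_simps fun_eq_iff)

lemma scale_add: "(a + b) \<triangleright> m = a \<triangleright> m + b \<triangleright> m"
  by (simp add: scale_def fn_ext act_add fn_diff_funs)

lemma scale_mult: "(a * b) \<triangleright> m = a \<triangleright> b \<triangleright> m"
  by (simp add: scale_def fn_ext act_mult fn_diff_funs)

lemma scale_one [simp]: "1 \<triangleright> m = m"
  by (simp add: scale_def fn_ext act_one)

lemma scale_zero [simp]: "0 \<triangleright> m = 0"
  using scale_add[of 0 0 m] by simp

lemma scale_uminus: "(- a) \<triangleright> m = - (a \<triangleright> m)"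
  using scale_add[of a "- a" m] by (simp add: eq_neg_iff_add_eq_0 add.commute)

lemma scale_minus: "(a - b) \<triangleright> m = a \<triangleright> m - b \<triangleright> m"
  using scale_add[of a "- b" m] by (simp add: scale_uminus)

lemma scale_add_right: "a \<triangleright> (m + n) = a \<triangleright> m + a \<triangleright> n"
  by (simp add: scale_def act_add_right fn_diff_funs)

lemma scale_zero_right [simp]: "a \<triangleright> 0 = 0"
  using scale_add_right[of a 0 0] by simp

lemma scale_uminus_right: "a \<triangleright> (- m) = - (a \<triangleright> m)"
  using scale_add_right[of a m "- m"] by (simp add: eq_neg_iff_add_eq_0 add.commute)

lemma scale_minus_right: "a \<triangleright> (m - n) = a \<triangleright> m - a \<triangleright> n"
  using scale_add_right[of a m "- n"] by (simp add: scale_uminus_right)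

lemma scale_times: "a \<triangleright> (m * n) = (a \<triangleright> m) * n"
  by (simp add: scale_def act_times fn_diff_funs)

lemma scale_times_right: "m * (a \<triangleright> n) = a \<triangleright> (m * n)"
  using scale_times[of a n m] by (simp add: mult.commute)

lemma scale_times_scale: "(a \<triangleright> m) * (b \<triangleright> n) = (a * b) \<triangleright> (m * n)"
  by (simp only: scale_times_right scale_times[symmetric] scale_mult[symmetric] mult.commute[of b a])

lemma scale_sum_right: "a \<triangleright> (\<Sum>x\<in>F. f x) = (\<Sum>x\<in>F. a \<triangleright> f x)"
  by (induction F rule: infinite_finite_induct) (simp_all add: scale_add_right)

lemma D_scale: "D (a \<triangleright> m) = dt a \<triangleright> m + a \<triangleright> D m"
  by (simp add: scale_def D_act fn_diff_funs dt.rep_eq)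

lemma D_zero [simp]: "D 0 = 0"
  using D_add[of 0 0] by simp

lemma D_uminus: "D (- m) = - D m"
  using D_add[of m "- m"] by (simp add: eq_neg_iff_add_eq_0 add.commute)

lemma D_minus: "D (m - n) = D m - D n"
  using D_add[of m "- n"] by (simp add: D_uminus)

lemma Dpow_add: "(D ^^ k) (m + n) = (D ^^ k) m + (D ^^ k) n"
  by (induction k) (simp_all add: D_add)

lemma D_Dinv [simp]: "D (Dinv m) = m"
  by (simp add: D_bij bij_is_surj surj_f_inv_f)

lemma Dinv_D [simp]: "Dinv (D m) = m"
  by (simp add: D_bij bij_is_inj)

lemma Dinv_add: "Dinv (m + n) = Dinv m + Dinv n"
  by (metis D_add D_Dinv Dinv_D)

lemma Dinv_uminus: "Dinv (- m) = - Dinv m"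
  by (metis D_uminus D_Dinv Dinv_D)

lemma Dinv_minus: "Dinv (m - n) = Dinv m - Dinv n"
  by (metis D_minus D_Dinv Dinv_D)

definition frechet :: "jetfun \<Rightarrow> 'm \<times> 'm \<Rightarrow> 'm" where
  "frechet a X = coeff_frechet act D (fn a) X"

lemma vars_fn: "vars (fn a) = {v. pd v a \<noteq> 0}"
proof -
  have "partial v (fn a) = (\<lambda>u. 0) \<longleftrightarrow> pd v a = 0" for v
    using fn_inject[of "pd v a" 0] by (simp add: pd.rep_eq zero_jetfun.rep_eq)
  then show ?thesis by (simp add: vars_def)
qed

lemma finite_pd: "finite {v. pd v a \<noteq> 0}"
proof -
  obtain c where "fn a = eval_expr c" by (rule fn_cases)
  then show ?thesis
    using finite_subset[OF vars_eval_expr finite_expr_vars, of c] by (simp flip: vars_fn)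
qed

text \<open>Enlarging the index set lets the derivatives of several coefficients be summed over a
  common set.\<close>

lemma frechet_eq_sum:
  assumes "finite V" "\<And>v. v \<notin> V \<Longrightarrow> pd v a = 0"
  shows "frechet a X = (\<Sum>v\<in>V. pd v a \<triangleright> var_direction D X v)"
proof -
  have "frechet a X = (\<Sum>v\<in>{v. pd v a \<noteq> 0}. pd v a \<triangleright> var_direction D X v)"
    by (simp add: frechet_def coeff_frechet_def vars_fn scale_def pd.rep_eq)
  also have "\<dots> = (\<Sum>v\<in>V. pd v a \<triangleright> var_direction D X v)"
    using assms by (intro sum.mono_neutral_left) auto
  finally show ?thesis .
qed

lemma frechet_add: "frechet (a + b) X = frechet a X + frechet b X"
proof -
  define V where "V = {v. pd v a \<noteq> 0} \<union> {v. pd v b \<noteq> 0}"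
  have V: "finite V" "\<And>v. v \<notin> V \<Longrightarrow> pd v a = 0" "\<And>v. v \<notin> V \<Longrightarrow> pd v b = 0"
    by (auto simp: V_def finite_pd)
  have "frechet (a + b) X = (\<Sum>v\<in>V. pd v (a + b) \<triangleright> var_direction D X v)"
    by (rule frechet_eq_sum[OF V(1)]) (simp add: V pd_simps(3))
  also have "\<dots> = frechet a X + frechet b X"
    by (simp add: frechet_eq_sum[OF V(1,2)] frechet_eq_sum[OF V(1,3)] pd_simps(3) scale_add
        sum.distrib)
  finally show ?thesis .
qed

lemma frechet_zero [simp]: "frechet 0 X = 0"
  using frechet_add[of 0 0] by simp

lemma frechet_uminus: "frechet (- a) X = - frechet a X"
  using frechet_add[of a "- a"] by (simp add: eq_neg_iff_add_eq_0 add.commute)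

lemma frechet_const: "frechet (jconst r) X = 0"
  using frechet_eq_sum[of "{}" "jconst r" X] by (simp add: pd_rules)

fun gen_val :: "'m \<times> 'm \<Rightarrow> gen \<Rightarrow> 'm" where
  "gen_val P (J v) = var_direction D P v"
| "gen_val P W1 = Dinv (S11 \<triangleright> fst P + S12 \<triangleright> snd P)"
| "gen_val P W2 = Dinv (S21 \<triangleright> fst P + S22 \<triangleright> snd P)"

text \<open>A relation instead of a sum over all generators, of which there are infinitely many. A
  form determines its value, but not conversely, since the generators may satisfy further relations
  in the extension.\<close>

inductive lin_rep :: "'m \<times> 'm \<Rightarrow> (gen \<Rightarrow> jetfun) \<Rightarrow> 'm \<Rightarrow> bool" for P where
  lin_rep_gen: "lin_rep P (\<lambda>h. if h = g then 1 else 0) (gen_val P g)"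
| lin_rep_scale: "lin_rep P f m \<Longrightarrow> lin_rep P (\<lambda>g. c * f g) (c \<triangleright> m)"
| lin_rep_add: "lin_rep P f m \<Longrightarrow> lin_rep P f' m' \<Longrightarrow> lin_rep P (\<lambda>g. f g + f' g) (m + m')"

inductive bil_rep :: "'m \<times> 'm \<Rightarrow> 'm \<times> 'm \<Rightarrow> (gen \<Rightarrow> gen \<Rightarrow> jetfun) \<Rightarrow> 'm \<Rightarrow> bool" for P Q where
  bil_rep_tensor: "lin_rep P f m \<Longrightarrow> lin_rep Q f' m' \<Longrightarrow> bil_rep P Q (\<lambda>g h. f g * f' h) (m * m')"
| bil_rep_add: "bil_rep P Q B m \<Longrightarrow> bil_rep P Q B' m' \<Longrightarrow> bil_rep P Q (\<lambda>g h. B g h + B' g h) (m + m')"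

lemma lin_rep_cong:
  assumes "lin_rep P f m" "\<And>g. f' g = f g"
  shows "lin_rep P f' m"
proof -
  have "f' = f" using assms(2) by (rule ext)
  with assms(1) show ?thesis by simp
qed

lemma bil_rep_cong:
  assumes "bil_rep P Q B m" "\<And>g h. B' g h = B g h"
  shows "bil_rep P Q B' m"
proof -
  have "B' = B" using assms(2) by (intro ext)
  with assms(1) show ?thesis by simp
qed

lemma lin_rep_zero: "lin_rep P (\<lambda>g. 0) 0"
  using lin_rep_scale[OF lin_rep_gen, of P 0 W1] by simp

lemma bil_rep_zero: "bil_rep P Q (\<lambda>g h. 0) 0"
  using bil_rep_tensor[OF lin_rep_zero lin_rep_zero, of P Q] by simp

lemma bil_rep_scale: "bil_rep P Q B m \<Longrightarrow> bil_rep P Q (\<lambda>g h. c * B g h) (c \<triangleright> m)"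
proof (induction rule: bil_rep.induct)
  case (bil_rep_tensor f m f' m')
  then have "bil_rep P Q (\<lambda>g h. (c * f g) * f' h) ((c \<triangleright> m) * m')"
    by (intro bil_rep.bil_rep_tensor lin_rep_scale)
  then show ?case by (simp add: scale_times mult.assoc)
next
  case (bil_rep_add B m B' m')
  then show ?case by (simp add: distrib_left scale_add_right bil_rep.bil_rep_add)
qed

lemma bil_rep_minus:
  assumes "bil_rep P Q B m" "bil_rep P Q B' m'"
  shows "bil_rep P Q (\<lambda>g h. B g h - B' g h) (m - m')"
  using bil_rep_add[OF assms(1) bil_rep_scale[OF assms(2), of "- 1"]] by (simp add: scale_uminus)

lemma bil_rep_swap: "bil_rep P Q B m \<Longrightarrow> bil_rep Q P (\<lambda>g h. B h g) m"
proof (induction rule: bil_rep.induct)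
  case (bil_rep_tensor f m f' m')
  then show ?case using bil_rep.bil_rep_tensor[of Q f' m' P f m] by (simp add: mult.commute)
next
  case (bil_rep_add B m B' m')
  then show ?case by (simp add: bil_rep.bil_rep_add)
qed

text \<open>The symbolic derivative is sound because D maps a jet generator to the next one and
  undoes the inverse in \<open>W1\<close> and \<open>W2\<close>, giving s_l . P. The Leibniz rule
  and additivity do the rest.\<close>

lemma lin_rep_D: "lin_rep P f m \<Longrightarrow> lin_rep P (lin_D f) (D m)"
proof (induction rule: lin_rep.induct)
  case (lin_rep_gen g)
  have w: "lin_rep P (lin_D (\<lambda>h. if h = w then 1 else 0)) (s \<triangleright> fst P + t \<triangleright> snd P)"
    if "\<And>h. lin_D (\<lambda>h. if h = w then 1 else 0) h = s * (if h = p0 then 1 else 0) + t * (if h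
        = q0 then 1 else 0)"
    for w s t
    using lin_rep_cong[OF lin_rep_add[OF lin_rep_scale[OF lin_rep.lin_rep_gen[of P p0], of s]
        lin_rep_scale[OF lin_rep.lin_rep_gen[of P q0], of t]] that] by simp
  have j: "lin_rep P (lin_D (\<lambda>h. if h = w then 1 else 0)) (gen_val P w')"
    if "\<And>h. lin_D (\<lambda>h. if h = w then 1 else 0) h = (if h = w' then 1 else 0)" for w w'
    using lin_rep_cong[OF lin_rep.lin_rep_gen[of P w'] that] .
  show ?case
  proof (cases g)
    case (J v)
    have "lin_rep P (lin_D (\<lambda>h. if h = J v then 1 else 0)) (gen_val P (J (next_var v)))"
      by (rule j, rule_tac g = h in gen_exhaust; cases v; simp add: lin_D_def dt_rules)
    moreover have "gen_val P (J (next_var v)) = D (gen_val P (J v))"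
      by (cases v) simp_all
    ultimately show ?thesis by (simp add: J)
  next
    case W1
    have "lin_rep P (lin_D (\<lambda>h. if h = W1 then 1 else 0)) (S11 \<triangleright> fst P + S12 \<triangleright> snd P)"
      by (rule w, rule_tac g = h in gen_exhaust; simp add: lin_D_def dt_rules)
    then show ?thesis by (simp add: W1)
  next
    case W2
    have "lin_rep P (lin_D (\<lambda>h. if h = W2 then 1 else 0)) (S21 \<triangleright> fst P + S22 \<triangleright> snd P)"
      by (rule w, rule_tac g = h in gen_exhaust; simp add: lin_D_def dt_rules)
    then show ?thesis by (simp add: W2)
  qed
next
  case (lin_rep_scale f m c)
  have "lin_D (\<lambda>g. c * f g) = (\<lambda>g. dt c * f g + c * lin_D f g)"
    by (simp add: fun_eq_iff lin_D_def shift_linear dt_rules algebra_simps)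
  then show ?case
    by (simp add: D_scale lin_rep_add lin_rep.lin_rep_scale lin_rep_scale)
next
  case (lin_rep_add f m f' m')
  have "lin_D (\<lambda>g. f g + f' g) = (\<lambda>g. lin_D f g + lin_D f' g)"
    by (simp add: fun_eq_iff lin_D_def shift_linear dt_rules algebra_simps)
  then show ?case
    by (simp add: D_add lin_rep.lin_rep_add lin_rep_add)
qed

lemma bil_rep_D: "bil_rep P Q B m \<Longrightarrow> bil_rep P Q (bil_D B) (D m)"
proof (induction rule: bil_rep.induct)
  case (bil_rep_tensor f m f' m')
  have "bil_D (\<lambda>g h. f g * f' h) = (\<lambda>g h. lin_D f g * f' h + f g * lin_D f' h)"
    by (simp add: fun_eq_iff bil_D_def lin_D_def shift_linear dt_rules algebra_simps)
  with bil_rep_tensor show ?case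
    by (simp add: D_times bil_rep.bil_rep_add bil_rep.bil_rep_tensor lin_rep_D)
next
  case (bil_rep_add B m B' m')
  have "bil_D (\<lambda>g h. B g h + B' g h) = (\<lambda>g h. bil_D B g h + bil_D B' g h)"
    by (simp add: fun_eq_iff bil_D_def shift_linear dt_rules algebra_simps)
  with bil_rep_add show ?case
    by (simp add: D_add bil_rep.bil_rep_add)
qed

text \<open>The sum is taken over every finite set above some support, so that two representations
  can be compared on the union of their supports.\<close>

lemma lin_rep_imp_sum:
  "lin_rep P f m \<Longrightarrow> \<exists>F. finite F \<and> (\<forall>G. finite G \<longrightarrow> F \<subseteq> G \<longrightarrow> m = (\<Sum>g\<in>G. f g \<triangleright> gen_val P g))"
proof (induction rule: lin_rep.induct)
  case (lin_rep_gen g)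
  have "gen_val P g = (\<Sum>h\<in>G. (if h = g then 1 else 0) \<triangleright> gen_val P h)" if "finite G" "{g} \<subseteq> G" for G
  proof -
    have "(\<Sum>h\<in>G. (if h = g then 1 else 0) \<triangleright> gen_val P h) = (\<Sum>h\<in>G. if h = g then gen_val P h else 0)"
      by (rule sum.cong) auto
    with that show ?thesis by simp
  qed
  then show ?case by (intro exI[of _ "{g}"]) simp
next
  case (lin_rep_scale f m c)
  then obtain F where F: "finite F"
    "\<forall>G. finite G \<longrightarrow> F \<subseteq> G \<longrightarrow> m = (\<Sum>g\<in>G. f g \<triangleright> gen_val P g)" by (elim exE conjE)
  have "c \<triangleright> m = (\<Sum>g\<in>G. (c * f g) \<triangleright> gen_val P g)" if "finite G" "F \<subseteq> G" for G
    using F(2)[rule_format, OF that] by (simp add: scale_mult scale_sum_right)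
  with F(1) show ?case by (intro exI[of _ F]) simp
next
  case (lin_rep_add f m f' m')
  from lin_rep_add.IH(1) obtain F where F: "finite F"
    "\<forall>G. finite G \<longrightarrow> F \<subseteq> G \<longrightarrow> m = (\<Sum>g\<in>G. f g \<triangleright> gen_val P g)" by (elim exE conjE)
  from lin_rep_add.IH(2) obtain F' where F': "finite F'"
    "\<forall>G. finite G \<longrightarrow> F' \<subseteq> G \<longrightarrow> m' = (\<Sum>g\<in>G. f' g \<triangleright> gen_val P g)" by (elim exE conjE)
  have *: "m + m' = (\<Sum>g\<in>G. (f g + f' g) \<triangleright> gen_val P g)" if "finite G" "F \<union> F' \<subseteq> G" for G
    using that F(2)[rule_format, of G] F'(2)[rule_format, of G] by (simp add: scale_add sum.distrib)
  show ?case by (intro exI[of _ "F \<union> F'"] conjI allI impI *) (simp_all add: F(1) F'(1))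
qed

lemma bil_rep_imp_sum:
  "bil_rep P Q B m \<Longrightarrow> \<exists>F. finite F \<and> (\<forall>G. finite G \<longrightarrow> F \<subseteq> G \<longrightarrow>
     m = (\<Sum>g\<in>G. \<Sum>h\<in>G. B g h \<triangleright> (gen_val P g * gen_val Q h)))"
proof (induction rule: bil_rep.induct)
  case (bil_rep_tensor f m f' m')
  from lin_rep_imp_sum[OF bil_rep_tensor(1)] obtain F where F: "finite F"
    "\<forall>G. finite G \<longrightarrow> F \<subseteq> G \<longrightarrow> m = (\<Sum>g\<in>G. f g \<triangleright> gen_val P g)" by (elim exE conjE)
  from lin_rep_imp_sum[OF bil_rep_tensor(2)] obtain F' where F': "finite F'"
    "\<forall>G. finite G \<longrightarrow> F' \<subseteq> G \<longrightarrow> m' = (\<Sum>g\<in>G. f' g \<triangleright> gen_val Q g)" by (elim exE conjE)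
  have *: "m * m' = (\<Sum>g\<in>G. \<Sum>h\<in>G. (f g * f' h) \<triangleright> (gen_val P g * gen_val Q h))"
    if "finite G" "F \<union> F' \<subseteq> G" for G
  proof -
    have "F \<subseteq> G" "F' \<subseteq> G" using that(2) by auto
    then show ?thesis
      by (simp only: F(2)[rule_format, OF that(1)] F'(2)[rule_format, OF that(1)] sum_product
          scale_times_scale)
  qed
  show ?case by (intro exI[of _ "F \<union> F'"] conjI allI impI *) (simp_all add: F(1) F'(1))
next
  case (bil_rep_add B m B' m')
  from bil_rep_add.IH(1) obtain F where F: "finite F"
    "\<forall>G. finite G \<longrightarrow> F \<subseteq> G \<longrightarrow> m = (\<Sum>g\<in>G. \<Sum>h\<in>G. B g h \<triangleright> (gen_val P g * gen_val Q h))" by (elim exE conjE)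
  from bil_rep_add.IH(2) obtain F' where F': "finite F'"
    "\<forall>G. finite G \<longrightarrow> F' \<subseteq> G \<longrightarrow> m' = (\<Sum>g\<in>G. \<Sum>h\<in>G. B' g h \<triangleright> (gen_val P g * gen_val Q h))"
        by (elim exE conjE)
  have *: "m + m' = (\<Sum>g\<in>G. \<Sum>h\<in>G. (B g h + B' g h) \<triangleright> (gen_val P g * gen_val Q h))"
    if "finite G" "F \<union> F' \<subseteq> G" for G
    using that F(2)[rule_format, of G] F'(2)[rule_format, of G] by (simp add: scale_add sum.distrib)
  show ?case by (intro exI[of _ "F \<union> F'"] conjI allI impI *) (simp_all add: F(1) F'(1))
qed

lemma bil_rep_unique:
  assumes "bil_rep P Q B m" "bil_rep P Q B m'"
  shows "m = m'"
proof -
  from bil_rep_imp_sum[OF assms(1)] obtain F where F: "finite F"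
    "\<forall>G. finite G \<longrightarrow> F \<subseteq> G \<longrightarrow> m = (\<Sum>g\<in>G. \<Sum>h\<in>G. B g h \<triangleright> (gen_val P g * gen_val Q h))" by (elim exE conjE)
  from bil_rep_imp_sum[OF assms(2)] obtain F' where F': "finite F'"
    "\<forall>G. finite G \<longrightarrow> F' \<subseteq> G \<longrightarrow> m' = (\<Sum>g\<in>G. \<Sum>h\<in>G. B g h \<triangleright> (gen_val P g * gen_val Q h))"
        by (elim exE conjE)
  show ?thesis
    using F(2)[rule_format, of "F \<union> F'"] F'(2)[rule_format, of "F \<union> F'"] F(1) F'(1) by simp
qed

text \<open>Exchanging the arguments transposes the form, and a form has only one value. This
  carries the symmetries of the coefficient tables over to the extension.\<close>

lemma bil_rep_symmetric:
  assumes "\<And>P Q. bil_rep P Q B (M P Q)" "\<And>g h. B g h = B h g"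
  shows "M P Q = M Q P"
proof -
  have "(\<lambda>g h. B h g) = B" using assms(2) by (simp add: fun_eq_iff)
  with bil_rep_swap[OF assms(1)[of Q P]] assms(1)[of P Q] show ?thesis
    by (metis bil_rep_unique)
qed

lemma lin_rep_list:
  assumes "distinct gs" "\<And>g. g \<notin> set gs \<Longrightarrow> f g = 0"
  shows "lin_rep P f (\<Sum>g\<leftarrow>gs. f g \<triangleright> gen_val P g)"
proof -
  have 1: "lin_rep P (\<lambda>h. \<Sum>g\<leftarrow>gs. c g * (if h = g then 1 else 0)) (\<Sum>g\<leftarrow>gs. c g \<triangleright> gen_val P g)" for gs c
    by (induction gs) (simp_all add: lin_rep_zero lin_rep_add lin_rep_scale lin_rep_gen)
  have 2: "(\<Sum>g\<leftarrow>gs. f g * (if h = g then 1 else 0)) = (if h \<in> set gs then f h else 0)" for h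
    using assms(1) by (induction gs) auto
  show ?thesis
    by (rule lin_rep_cong[OF 1]) (simp add: 2 assms(2))
qed

lemma bil_rep_list:
  assumes "distinct gs" "\<And>h g. h \<notin> set gs \<Longrightarrow> f h g = 0" "\<And>h. lin_rep P (f h) (m h)"
  shows "bil_rep P Q (\<lambda>g h. f h g) (\<Sum>h\<leftarrow>gs. m h * gen_val Q h)"
proof -
  have 1: "bil_rep P Q (\<lambda>g h'. \<Sum>h\<leftarrow>gs. f h g * (if h'
      = h then 1 else 0)) (\<Sum>h\<leftarrow>gs. m h * gen_val Q h)" for gs
    by (induction gs) (simp_all add: bil_rep_zero bil_rep_add bil_rep_tensor[OF assms(3) lin_rep_gen])
  have 2: "(\<Sum>h\<leftarrow>gs. f h g * (if h' = h then 1 else 0)) = (if h' \<in> set gs then f h' g else 0)" for h' g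
    using assms(1) by (induction gs) auto
  show ?thesis
    by (rule bil_rep_cong[OF 1]) (simp add: 2 assms(2))
qed

lemma lin_rep_frechet_form: "lin_rep P (frechet_form a) (frechet a P)"
proof -
  obtain vs where vs: "distinct vs" "set vs = {v. pd v a \<noteq> 0}"
    using finite_distinct_list[OF finite_pd, of a] by (elim exE conjE)
  have "frechet a P = (\<Sum>v\<leftarrow>vs. pd v a \<triangleright> var_direction D P v)"
    by (subst frechet_eq_sum[of "set vs"]) (simp_all add: vs sum.distinct_set_conv_list[OF vs(1),
        unfolded vs(2)] finite_pd)
  also have "\<dots> = (\<Sum>g\<leftarrow>map J vs. frechet_form a g \<triangleright> gen_val P g)"
    by (simp add: comp_def)
  finally have *: "frechet a P = \<dots>" .
  show ?thesis
    unfolding *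
  proof (rule lin_rep_list)
    show "frechet_form a g = 0" if "g \<notin> set (map J vs)" for g
      using that vs(2) by (cases g) auto
  qed (simp add: vs(1) distinct_map inj_on_def)
qed

section \<open>The action of the operator and of its derivative in terms of generators\<close>

abbreviation proj :: "component \<Rightarrow> 'm \<times> 'm \<Rightarrow> 'm" where
  "proj i P \<equiv> (case i of C1 \<Rightarrow> fst P | C2 \<Rightarrow> snd P)"

abbreviation R_apply :: "'m \<times> 'm \<Rightarrow> 'm \<times> 'm" where
  "R_apply \<equiv> mat_apply act D R_op"

abbreviation R_frechet :: "'m \<times> 'm \<Rightarrow> 'm \<times> 'm \<Rightarrow> 'm \<times> 'm" where
  "R_frechet \<equiv> mat_frechet act D R_op"

lemma frechet_minus: "frechet (a - b) P = frechet a P - frechet b P"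
  using frechet_add[of a "- b" P] by (simp add: frechet_uminus)

lemma frechet_one: "frechet 1 P = 0" "frechet (-1) P = 0"
  using frechet_const[of 1 P] frechet_uminus[of 1 P]
  by (simp_all add: jetfun_eqI[of "jconst 1" 1] fn_simps)

text \<open>A normal form for the entries: a third-order local part and two nonlocal terms. As
  expressions obey no laws, it is imposed on the action and on the differentiated action
  separately.\<close>

definition op_rep :: "pdo \<Rightarrow> (nat \<Rightarrow> jetfun) \<Rightarrow> jetfun \<Rightarrow> jetfun \<Rightarrow> jetfun \<Rightarrow> jetfun \<Rightarrow> bool" where
  "op_rep X c A1 s1 A2 s2 \<longleftrightarrow>
     (\<forall>m. pdo_apply act D X m = c 0 \<triangleright> m + c 1 \<triangleright> D m + c 2 \<triangleright> D (D m) + c 3 \<triangleright> D (D (D m))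
        + A1 \<triangleright> Dinv (s1 \<triangleright> m) + A2 \<triangleright> Dinv (s2 \<triangleright> m)) \<and>
     (\<forall>P m. pdo_frechet act D X P m = frechet (c 0) P * m + frechet (c 1) P * D m
         + frechet (c 2) P * D (D m) + frechet (c 3) P * D (D (D m))
        + frechet A1 P * Dinv (s1 \<triangleright> m) + A1 \<triangleright> Dinv (frechet s1 P * m)
        + frechet A2 P * Dinv (s2 \<triangleright> m) + A2 \<triangleright> Dinv (frechet s2 P * m))"

lemma op_rep_ops:
  assumes "X = op_plus c3 c2 c1 c0 c0' c0'' A2 s2 A1 s1 \<and> c 0 = c0 + c0' + c0'' \<or>
      X = op_minus c3 c2 c1 c0 c0' c0'' A2 s2 A1 s1 \<and> c 0 = - c0 + c0' + c0''"
    "c 1 = c1" "c 2 = c2" "c 3 = c3"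
  shows "op_rep X c (- A1) s1 (- A2) s2"
  using assms(1) unfolding op_rep_def assms(2-4)
  by (elim disjE conjE;
      simp add: op_plus_def op_minus_def pdo_defs numeral_3_eq_3 numeral_2_eq_2 coeff_one
      scale_add scale_minus scale_uminus frechet_add frechet_minus frechet_uminus frechet_one
          flip: scale_def frechet_def;
      simp add: algebra_simps)

lemma op_rep_uminus:
  assumes "op_rep X c A1 s1 A2 s2"
  shows "op_rep (- X) (\<lambda>k. - c k) (- A1) s1 (- A2) s2"
  using assms unfolding op_rep_def
  by (simp add: pdo_defs coeff_one scale_uminus frechet_uminus frechet_one
      flip: scale_def frechet_def)

text \<open>A sign passes through the inverse of D. This is used because interchanging the dependent
  variables maps \<open>S21\<close>, \<open>S22\<close> to \<open>- S22\<close>,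
  \<open>- S21\<close>.\<close>

lemma op_rep_neg_gradients:
  assumes "op_rep X c A1 s1 A2 s2"
  shows "op_rep X c A1 s1 (- A2) (- s2)"
  using assms unfolding op_rep_def
  by (simp add: scale_uminus frechet_uminus Dinv_uminus scale_uminus_right)

lemma swp_S: "swp S11 = S12" "swp S12 = S11" "swp S21 = - S22" "swp S22 = - S21"
  by (simp_all add: S11_def S12_def S21_def S22_def swp_rules algebra_simps)

definition R_row :: "component \<Rightarrow> component \<Rightarrow> nat \<Rightarrow> jetfun" where
  "R_row i j k = R_form i (J (case j of C1 \<Rightarrow> \<phi>\<^sub>1 k | C2 \<Rightarrow> \<phi>\<^sub>2 k))"

lemma R_row_simps: 
  "R_row i C1 k = R_form i (J (\<phi>\<^sub>1 k))" "R_row i C2 k = R_form i (J (\<phi>\<^sub>2 k))"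
  by (simp_all add: R_row_def)

lemmas num_nth0 = One_nat_def numeral_2_eq_2 numeral_3_eq_3 nth0.simps nat.case

lemma op_rep_R:
  "op_rep R11 (R_row C1 C1) (R_form C1 W1) S11 (R_form C1 W2) S21"
  "op_rep R12 (R_row C1 C2) (R_form C1 W1) S12 (R_form C1 W2) S22"
  "op_rep (- pdo_swap R12) (R_row C2 C1) (R_form C2 W1) S11 (R_form C2 W2) S21"
  "op_rep (- pdo_swap R11) (R_row C2 C2) (R_form C2 W1) S12 (R_form C2 W2) S22"
proof -
  have A: "R_form C1 W1 = - (ninth * K1_poly)" "R_form C1 W2 = - (ninth * a1)"
    "R_form C2 W1 = ninth * swp K1_poly" "R_form C2 W2 = - (ninth * b1)"
    by (simp_all add: K1_poly_def swp_rules algebra_simps)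
  show "op_rep R11 (R_row C1 C1) (R_form C1 W1) S11 (R_form C1 W2) S21"
    unfolding A R11_eq
    by (rule op_rep_ops, rule disjI2, rule conjI, rule refl)
      (simp_all add: R_row_simps num_nth0 algebra_simps)
  show "op_rep R12 (R_row C1 C2) (R_form C1 W1) S12 (R_form C1 W2) S22"
    unfolding A R12_eq
    by (rule op_rep_ops, rule disjI1, rule conjI, rule refl)
      (simp_all add: R_row_simps num_nth0 algebra_simps)
  \<comment> \<open>Relative to the first row, the outer minus sign reverses the sign of the
    \<open>W1\<close> term, whereas in the \<open>W2\<close> term it cancels against the sign
    produced by the swap.\<close>
  have 1: "op_rep (pdo_swap R12) (\<lambda>k.
      - R_row C2 C1 k) (- (ninth * swp K1_poly)) S11 (- (ninth * b1)) (- S21)"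
    unfolding R12_eq swap_ops swp_rules ninth_rules swp_S swap_var.simps
    by (rule op_rep_ops, rule disjI1, rule conjI, rule refl)
      (simp_all add: R_row_simps num_nth0 algebra_simps)
  show "op_rep (- pdo_swap R12) (R_row C2 C1) (R_form C2 W1) S11 (R_form C2 W2) S21"
    using op_rep_neg_gradients[OF op_rep_uminus[OF 1]] by (simp only: A minus_minus)
  have 2: "op_rep (pdo_swap R11) (\<lambda>k.
      - R_row C2 C2 k) (- (ninth * swp K1_poly)) S12 (- (ninth * b1)) (- S22)"
    unfolding R11_eq swap_ops swp_rules ninth_rules swp_S swap_var.simps
    by (rule op_rep_ops, rule disjI2, rule conjI, rule refl)
      (simp_all add: R_row_simps num_nth0 algebra_simps)
  show "op_rep (- pdo_swap R11) (R_row C2 C2) (R_form C2 W1) S12 (R_form C2 W2) S22"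
    using op_rep_neg_gradients[OF op_rep_uminus[OF 2]] by (simp only: A minus_minus)
qed

lemmas R_equations = op_rep_R[unfolded op_rep_def, THEN conjunct1, rule_format]
  op_rep_R[unfolded op_rep_def, THEN conjunct2, rule_format]

lemma R_apply_eq: "proj i (R_apply P) = (\<Sum>g\<leftarrow>gens3. R_form i g \<triangleright> gen_val P g)"
  by (cases i) (simp_all del: R_form.simps add: R_op_def R_equations R_row_simps numeral_3_eq_3
      numeral_2_eq_2 Dinv_add scale_add_right algebra_simps)

text \<open>Differentiating s_l inside a nonlocal term puts the inverse of D in front of a bilinear
  expression, which is outside the span of products of generators. The tables \<open>beta\<close>
  serve to remove these terms.\<close>

lemma R_frechet_eq: "proj i (R_frechet X Q) = (\<Sum>g\<leftarrow>gens3. frechet (R_form i g) X * gen_val Q g)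
    + R_form i W1 \<triangleright> Dinv (frechet S11 X * fst Q + frechet S12 X * snd Q)
    + R_form i W2 \<triangleright> Dinv (frechet S21 X * fst Q + frechet S22 X * snd Q)"
  by (cases i) (simp_all del: R_form.simps add: R_op_def R_equations R_row_simps numeral_3_eq_3
      numeral_2_eq_2 Dinv_add scale_add_right algebra_simps)

lemma lin_rep_R_apply: "lin_rep P (R_form i) (proj i (R_apply P))"
  unfolding R_apply_eq by (rule lin_rep_list) (simp, rule R_form_outside)

lemma lin_rep_Dpow: "lin_rep P f m \<Longrightarrow> lin_rep P ((lin_D ^^ k) f) ((D ^^ k) m)"
  by (induction k) (simp_all add: lin_rep_D)

lemma lin_rep_frechet_R_form:
  assumes "order_le3 a"
  shows "lin_rep P (frechet_R_form a) (frechet a (R_apply P))"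
proof -
  let ?V = "{\<phi>\<^sub>1 0, \<phi>\<^sub>2 0, \<phi>\<^sub>1 1, \<phi>\<^sub>2 1, \<phi>\<^sub>1 2, \<phi>\<^sub>2 2, \<phi>\<^sub>1 3, \<phi>\<^sub>2 3}"
  have V: "pd v a = 0" if "v \<notin> ?V" for v
  proof -
    have "3 < jet_order v"
    proof (cases v)
      case (\<phi>\<^sub>1 k)
      with that have "k \<noteq> 0" "k \<noteq> 1" "k \<noteq> 2" "k \<noteq> 3" by auto
      then show ?thesis using \<phi>\<^sub>1 by simp
    next
      case (\<phi>\<^sub>2 k)
      with that have "k \<noteq> 0" "k \<noteq> 1" "k \<noteq> 2" "k \<noteq> 3" by auto
      then show ?thesis using \<phi>\<^sub>2 by simp
    qed
    with assms show ?thesis by (simp add: order_le3_def)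
  qed
  have R: "lin_rep P (R_form C1) (fst (R_apply P))" "lin_rep P (R_form C2) (snd (R_apply P))"
    using lin_rep_R_apply[of P C1] lin_rep_R_apply[of P C2] by simp_all
  have *: "frechet a (R_apply P) = (\<Sum>v\<in>?V. pd v a \<triangleright> var_direction D (R_apply P) v)"
    by (rule frechet_eq_sum) (simp, rule V)
  \<comment> \<open>The right-nested shape is that of the unfolded sum over \<open>?V\<close>, term
    by term in the order of listing.\<close>
  have "lin_rep P (\<lambda>g. pd (\<phi>\<^sub>1 0) a * (lin_D ^^ 0) (R_form C1) g
      + (pd (\<phi>\<^sub>2 0) a * (lin_D ^^ 0) (R_form C2) g
   + (pd (\<phi>\<^sub>1 1) a * (lin_D ^^ 1) (R_form C1) g + (pd (\<phi>\<^sub>2 1) a * (lin_D ^^ 1) (R_form C2) g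
   + (pd (\<phi>\<^sub>1 2) a * (lin_D ^^ 2) (R_form C1) g + (pd (\<phi>\<^sub>2 2) a * (lin_D ^^ 2) (R_form C2) g
   + (pd (\<phi>\<^sub>1 3) a * (lin_D ^^ 3) (R_form C1) g + pd (\<phi>\<^sub>2 3) a * (lin_D ^^ 3) (R_form C2) g)))))))
   (pd (\<phi>\<^sub>1 0) a \<triangleright> (D ^^ 0) (fst (R_apply P)) + (pd (\<phi>\<^sub>2 0) a \<triangleright> (D ^^ 0) (snd (R_apply P))
   + (pd (\<phi>\<^sub>1 1) a \<triangleright> (D ^^ 1) (fst (R_apply P)) + (pd (\<phi>\<^sub>2 1) a \<triangleright> (D ^^ 1) (snd (R_apply P))
   + (pd (\<phi>\<^sub>1 2) a \<triangleright> (D ^^ 2) (fst (R_apply P)) + (pd (\<phi>\<^sub>2 2) a \<triangleright> (D ^^ 2) (snd (R_apply P))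
   + (pd (\<phi>\<^sub>1 3) a \<triangleright> (D ^^ 3) (fst (R_apply P)) + pd (\<phi>\<^sub>2 3) a \<triangleright> (D ^^ 3) (snd (R_apply P)))))))))"
    by (intro lin_rep_add lin_rep_scale lin_rep_Dpow R)
  moreover have "frechet a (R_apply P) = \<dots>"
    unfolding * by simp
  ultimately have "lin_rep P (\<lambda>g. pd (\<phi>\<^sub>1 0) a * (lin_D ^^ 0) (R_form C1) g
      + (pd (\<phi>\<^sub>2 0) a * (lin_D ^^ 0) (R_form C2) g
   + (pd (\<phi>\<^sub>1 1) a * (lin_D ^^ 1) (R_form C1) g + (pd (\<phi>\<^sub>2 1) a * (lin_D ^^ 1) (R_form C2) g
   + (pd (\<phi>\<^sub>1 2) a * (lin_D ^^ 2) (R_form C1) g + (pd (\<phi>\<^sub>2 2) a * (lin_D ^^ 2) (R_form C2) g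
   + (pd (\<phi>\<^sub>1 3) a * (lin_D ^^ 3) (R_form C1) g
       + pd (\<phi>\<^sub>2 3) a * (lin_D ^^ 3) (R_form C2) g))))))) (frechet a (R_apply P))"
    by (simp only:)
  then show ?thesis
    by (rule lin_rep_cong) (simp add: frechet_R_form_def numeral_2_eq_2 numeral_3_eq_3 add.assoc)
qed

section \<open>Values of the bilinear forms\<close>

definition table_val :: "(gen \<times> gen \<times> jetfun) list \<Rightarrow> 'm \<times> 'm \<Rightarrow> 'm \<times> 'm \<Rightarrow> 'm" where
  "table_val es P Q = (\<Sum>e\<leftarrow>es. snd (snd e) \<triangleright> (gen_val P (fst e) * gen_val Q (fst (snd e))))"

lemma bil_rep_table: "bil_rep P Q (table_form es) (table_val es P Q)"
proof (induction es)
  case Nil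
  have "table_form [] = (\<lambda>g h. 0)" by (intro ext) simp
  then show ?case by (simp add: table_val_def bil_rep_zero)
next
  case (Cons e es)
  have "bil_rep P Q (\<lambda>g h. snd (snd e) * ((if g = fst e then 1 else 0) * (if h
      = fst (snd e) then 1 else 0)) + table_form es g h)
    (snd (snd e) \<triangleright> (gen_val P (fst e) * gen_val Q (fst (snd e))) + table_val es P Q)"
    by (intro bil_rep_add bil_rep_scale bil_rep_tensor lin_rep_gen Cons)
  then have "bil_rep P Q (table_form (e # es)) (snd (snd e) \<triangleright> (gen_val P (fst e) * gen_val Q (fst
      (snd e))) + table_val es P Q)"
    by (rule bil_rep_cong) simp
  then show ?case by (simp only: table_val_def list.map sum_list.Cons)
qed

lemma bil_rep_pairing:
  assumes "lin_rep P f m" "lin_rep P f' m'"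
  shows "bil_rep P Q (pairing f f') (m * fst Q + m' * snd Q)"
proof -
  have "bil_rep P Q (\<lambda>g h. f g * (if h = p0 then 1 else 0) + f' g * (if h = q0 then 1 else 0))
      (m * gen_val Q p0 + m' * gen_val Q q0)"
    by (intro bil_rep_add bil_rep_tensor lin_rep_gen assms)
  then have "bil_rep P Q (pairing f f') (m * gen_val Q p0 + m' * gen_val Q q0)"
  proof (rule bil_rep_cong)
    show "pairing f f' g h = f g * (if h = p0 then 1 else 0) + f' g * (if h
        = q0 then 1 else 0)" for g h
      by (rule gen_exhaust[of h]) simp_all
  qed
  then show ?thesis by simp
qed

definition dR_val :: "component \<Rightarrow> 'm \<times> 'm \<Rightarrow> 'm \<times> 'm \<Rightarrow> 'm" where
  "dR_val i P Q = (\<Sum>g\<leftarrow>gens3. frechet (R_form i g) P * gen_val Q g)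
     + R_form i W1 \<triangleright> table_val (beta W1) P Q + R_form i W2 \<triangleright> table_val (beta W2) P Q"

lemma bil_rep_dR_val: "bil_rep P Q (dR_form i) (dR_val i P Q)"
proof -
  have "bil_rep P Q (\<lambda>g h. frechet_form (R_form i h) g) (\<Sum>g\<leftarrow>gens3. frechet (R_form i g) P * gen_val
      Q g)"
  proof (rule bil_rep_list)
    show "frechet_form (R_form i h) g = 0" if "h \<notin> set gens3" for h g
      using R_form_outside[OF that] by (cases g) (simp_all add: pd_rules)
  qed (simp_all add: lin_rep_frechet_form)
  then have "bil_rep P Q (\<lambda>g h. frechet_form (R_form i h) g + R_form i W1 * table_form (beta W1) g h
      + R_form i W2 * table_form (beta W2) g h) (dR_val i P Q)"
    unfolding dR_val_def by (intro bil_rep_add bil_rep_scale bil_rep_table)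
  then show ?thesis by (rule bil_rep_cong) (simp add: dR_form_def)
qed

definition gradient_pairing :: "gen \<Rightarrow> 'm \<times> 'm \<Rightarrow> 'm \<times> 'm \<Rightarrow> 'm" where
  "gradient_pairing l P Q = frechet (gradient l C1) P * fst Q + frechet (gradient l C2) P * snd Q"

text \<open>This is X_l of the outline, with R'[P] Q replaced by its corrected version
  \<open>dR_val\<close>.\<close>

definition integrand :: "gen \<Rightarrow> 'm \<times> 'm \<Rightarrow> 'm \<times> 'm \<Rightarrow> 'm" where
  "integrand l P Q = gradient_pairing l (R_apply P) Q - (gradient l C1 \<triangleright> dR_val C1 P Q
      + gradient l C2 \<triangleright> dR_val C2 P Q)"

definition torsion_val :: "component \<Rightarrow> 'm \<times> 'm \<Rightarrow> 'm \<times> 'm \<Rightarrow> 'm" where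
  "torsion_val i P Q = (\<Sum>g\<leftarrow>gens3. frechet (R_form i g) (R_apply P) * gen_val Q g)
     - (R_form i p0 \<triangleright> dR_val C1 P Q + R_form i q0 \<triangleright> dR_val C2 P Q
      + R_form i p1 \<triangleright> D (dR_val C1 P Q) + R_form i q1 \<triangleright> D (dR_val C2 P Q)
      + R_form i p2 \<triangleright> D (D (dR_val C1 P Q)) + R_form i q2 \<triangleright> D (D (dR_val C2 P Q))
      + R_form i p3 \<triangleright> D (D (D (dR_val C1 P Q))) + R_form i q3 \<triangleright> D (D (D (dR_val C2 P Q))))
     + R_form i W1 \<triangleright> table_val (upsilon W1) P Q + R_form i W2 \<triangleright> table_val (upsilon W2) P Q"

lemma bil_rep_gradient_pairing: "bil_rep P Q (beta_defect l) (gradient_pairing l P Q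
    - D (table_val (beta l) P Q))"
proof -
  have "bil_rep P Q (\<lambda>g h. pairing (frechet_form (gradient l C1)) (frechet_form (gradient l C2)) g h
      - bil_D (table_form (beta l)) g h)
      (gradient_pairing l P Q - D (table_val (beta l) P Q))"
    unfolding gradient_pairing_def
        by (intro bil_rep_minus bil_rep_pairing bil_rep_D bil_rep_table lin_rep_frechet_form)
  then show ?thesis by (rule bil_rep_cong) (simp add: beta_defect_def)
qed

lemma bil_rep_integrand: "bil_rep P Q (upsilon_defect l) (integrand l P Q
    - D (table_val (upsilon l) P Q))"
proof -
  have "bil_rep P Q (\<lambda>g h. pairing (frechet_R_form (gradient l C1)) (frechet_R_form (gradient l C2))
      g h
      - (gradient l C1 * dR_form C1 g h + gradient l C2 * dR_form C2 g h)
          - bil_D (table_form (upsilon l)) g h)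
      (integrand l P Q - D (table_val (upsilon l) P Q))"
    unfolding integrand_def gradient_pairing_def
    by (intro bil_rep_minus bil_rep_pairing bil_rep_add bil_rep_scale bil_rep_D bil_rep_table
        bil_rep_dR_val lin_rep_frechet_R_form order_le3_gradient)
  then show ?thesis by (rule bil_rep_cong) (simp add: upsilon_defect_def)
qed

lemma frechet_R_form_zero: "frechet_R_form 0 g = 0"
  by (simp add: frechet_R_form_def pd_rules)

lemma bil_rep_torsion_val: "bil_rep P Q (torsion_form i) (torsion_val i P Q)"
proof -
  have "bil_rep P Q (\<lambda>g h. frechet_R_form (R_form i h) g) (\<Sum>g\<leftarrow>gens3. frechet (R_form i g) (R_apply
      P) * gen_val Q g)"
  proof (rule bil_rep_list)
    show "frechet_R_form (R_form i h) g = 0" if "h \<notin> set gens3" for h g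
      using R_form_outside[OF that] by (simp add: frechet_R_form_zero)
    show "lin_rep P (frechet_R_form (R_form i h)) (frechet (R_form i h) (R_apply P))" for h
      by (intro lin_rep_frechet_R_form order_le3_R_form)
  qed simp
  then have "bil_rep P Q (\<lambda>g h. frechet_R_form (R_form i h) g
   - (R_form i p0 * dR_form C1 g h + R_form i q0 * dR_form C2 g h
    + R_form i p1 * bil_D (dR_form C1) g h + R_form i q1 * bil_D (dR_form C2) g h
    + R_form i p2 * bil_D (bil_D (dR_form C1)) g h + R_form i q2 * bil_D (bil_D (dR_form C2)) g h
    + R_form i p3 * bil_D (bil_D (bil_D (dR_form C1))) g h
        + R_form i q3 * bil_D (bil_D (bil_D (dR_form C2))) g h)
   + R_form i W1 * table_form (upsilon W1) g h
       + R_form i W2 * table_form (upsilon W2) g h) (torsion_val i P Q)"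
    unfolding torsion_val_def
        by (intro bil_rep_add bil_rep_minus bil_rep_scale bil_rep_D bil_rep_dR_val bil_rep_table)
  then show ?thesis by (rule bil_rep_cong) (simp add: torsion_form_def)
qed

lemma gen_val_add: "gen_val (P + Q) g = gen_val P g + gen_val Q g"
proof (cases g)
  case (J v)
  then show ?thesis by (cases v) (simp_all add: Dpow_add)
qed (simp_all add: scale_add_right Dinv_add algebra_simps flip: Dinv_add)

lemma R_apply_add: "R_apply (P + Q) = R_apply P + R_apply Q"
proof -
  have "proj i (R_apply (P + Q)) = proj i (R_apply P) + proj i (R_apply Q)" for i
    unfolding R_apply_eq gen_val_add scale_add_right sum_list_addf by simp
  from this[of C1] this[of C2] show ?thesis by (simp add: prod_eq_iff)
qed

lemma nijenhuis_symmetric_R: "nijenhuis_symmetric act D R_op"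
proof -
  \<comment> \<open>The symmetric defect is integrated: the inverse of D cancels on the table and
    preserves the symmetry.\<close>
  have S': "Dinv (gradient_pairing l P Q) - table_val (beta l) P Q = Dinv (gradient_pairing l Q P)
      - table_val (beta l) Q P"
    if "l \<in> {W1, W2}" for l P Q
  proof -
    have "gradient_pairing l P Q - D (table_val (beta l) P Q) = gradient_pairing l Q P
        - D (table_val (beta l) Q P)"
      by (rule bil_rep_symmetric[OF bil_rep_gradient_pairing beta_defect_symmetric[OF that]])
    then have "Dinv (gradient_pairing l P Q - D (table_val (beta l) P Q))
        = Dinv (gradient_pairing l Q P - D (table_val (beta l) Q P))"
      by (rule arg_cong)
    then show ?thesis by (simp add: Dinv_minus)
  qed
  have X': "Dinv (integrand l P Q) - table_val (upsilon l) P Q = Dinv (integrand l Q P)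
      - table_val (upsilon l) Q P"
    if "l \<in> {W1, W2}" for l P Q
  proof -
    have "integrand l P Q - D (table_val (upsilon l) P Q) = integrand l Q P
        - D (table_val (upsilon l) Q P)"
      by (rule bil_rep_symmetric[OF bil_rep_integrand upsilon_defect_symmetric[OF that]])
    then have "Dinv (integrand l P Q - D (table_val (upsilon l) P Q)) = Dinv (integrand l Q P
        - D (table_val (upsilon l) Q P))"
      by (rule arg_cong)
    then show ?thesis by (simp add: Dinv_minus)
  qed
  have T': "torsion_val i P Q = torsion_val i Q P" for i P Q
    by (rule bil_rep_symmetric[OF bil_rep_torsion_val torsion_form_symmetric])
  \<comment> \<open>The error made in replacing R'[P] Q by \<open>dR_val\<close>. It is symmetric by
    \<open>S'\<close>, so it disappears from the antisymmetric part even after R has been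
    applied.\<close>
  define K where "K P Q i = R_form i W1 \<triangleright> (Dinv (gradient_pairing W1 P Q) - table_val (beta W1) P Q)
     + R_form i W2 \<triangleright> (Dinv (gradient_pairing W2 P Q) - table_val (beta W2) P Q)" for P Q i
  have K: "K P Q i = K Q P i" for P Q i
    unfolding K_def by (simp only: S'[of _ P Q] insertI1 insertI2)
  have R_frechet: "R_frechet P Q = (dR_val C1 P Q + K P Q C1, dR_val C2 P Q + K P Q C2)" for P Q
  proof -
    have "proj i (R_frechet P Q) = dR_val i P Q + K P Q i" for i
      unfolding R_frechet_eq dR_val_def K_def gradient_pairing_def
          by (simp add: scale_minus_right del: R_form.simps)
    from this[of C1] this[of C2] show ?thesis by (simp add: prod_eq_iff)
  qed
  \<comment> \<open>The inverses from both terms merge into the inverse on \<open>integrand\<close>;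
    adding and subtracting the \<open>upsilon\<close> tables leaves the explicit torsion and terms
    symmetric by \<open>X'\<close>.\<close>
  have main: "proj i (R_frechet (R_apply P) Q) - proj i (R_apply (dR_val C1 P Q, dR_val C2 P Q))
      = torsion_val i P Q
      + R_form i W1 \<triangleright> (Dinv (integrand W1 P Q) - table_val (upsilon W1) P Q)
          + R_form i W2 \<triangleright> (Dinv (integrand W2 P Q) - table_val (upsilon W2) P Q)" for i P Q
    unfolding R_frechet_eq R_apply_eq torsion_val_def integrand_def gradient_pairing_def
    by (simp add: Dinv_minus Dinv_add scale_minus_right scale_add_right
        numeral_2_eq_2 numeral_3_eq_3 algebra_simps del: R_form.simps)
  have split: "proj i (R_frechet (R_apply P) Q - R_apply (R_frechet P Q)) =
      proj i (R_frechet (R_apply P) Q) - proj i (R_apply (dR_val C1 P Q, dR_val C2 P Q))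
          - proj i (R_apply (K P Q C1, K P Q C2))" for i P Q
  proof -
    have "R_frechet P Q = (dR_val C1 P Q, dR_val C2 P Q) + (K P Q C1, K P Q C2)"
        by (simp add: R_frechet)
    then have "R_apply (R_frechet P Q) = R_apply (dR_val C1 P Q, dR_val C2 P Q)
        + R_apply (K P Q C1, K P Q C2)"
      by (simp only: R_apply_add)
    then show ?thesis by (cases i) simp_all
  qed
  have "proj i (R_frechet (R_apply P) Q - R_apply (R_frechet P Q)) = proj i (R_frechet (R_apply Q) P
      - R_apply (R_frechet Q P))" for i P Q
    unfolding split main by (simp only: T'[of i P Q] X'[of _ P Q] K[of P Q] insertI1 insertI2)
  from this[where i = C1] this[where i = C2] have "R_frechet (R_apply P) Q - R_apply (R_frechet P Q)
      = R_frechet (R_apply Q) P - R_apply (R_frechet Q P)" for P Q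
    by (simp add: prod_eq_iff)
  then show ?thesis by (simp add: nijenhuis_symmetric_def)
qed

end

section \<open>The bracket form\<close>

primrec coeffs_in :: "(jet \<Rightarrow> real) set \<Rightarrow> pdo \<Rightarrow> bool" where
  "coeffs_in A (Coeff a) \<longleftrightarrow> a \<in> A"
| "coeffs_in A Dx \<longleftrightarrow> True"
| "coeffs_in A Dx_inv \<longleftrightarrow> True"
| "coeffs_in A (Sum X Y) \<longleftrightarrow> coeffs_in A X \<and> coeffs_in A Y"
| "coeffs_in A (Comp X Y) \<longleftrightarrow> coeffs_in A X \<and> coeffs_in A Y"

lemma coeffs_in_R:
  "coeffs_in diff_funs R11" "coeffs_in diff_funs R12"
  "coeffs_in diff_funs (- pdo_swap R12)" "coeffs_in diff_funs (- pdo_swap R11)"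
  unfolding R11_eq R12_eq swap_ops
  by (simp_all add: op_plus_def op_minus_def pdo_defs numeral_2_eq_2 numeral_3_eq_3 coeff_one
      fn_diff_funs)

context frechet_extension
begin

lemma fre_Dinv: "fre P (Dinv m) = Dinv (fre P m)"
  by (metis fre_D D_Dinv Dinv_D)

lemma fre_pdo_apply:
  "coeffs_in diff_funs X \<Longrightarrow>
   fre P (pdo_apply act D X m) = pdo_frechet act D X P m + pdo_apply act D X (fre P m)"
proof (induction X arbitrary: m)
  case (Sum X Y)
  then show ?case by (simp add: fre_add algebra_simps)
next
  case (Comp X Y)
  \<comment> \<open>The outer operator has to be distributed over the two Leibniz terms of the inner
    one.\<close>
  have add: "pdo_apply act D X (m + n) = pdo_apply act D X m + pdo_apply act D X n"
    if "coeffs_in diff_funs X" for X m n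
    using that
        by (induction X arbitrary: m n) (simp_all add: act_add_right D_add Dinv_add algebra_simps)
  from Comp show ?case by (simp add: add algebra_simps)
qed (simp_all add: fre_act fre_D fre_Dinv)

lemma fre_R_apply: "(fre P (fst (R_apply Q)), fre P (snd (R_apply Q))) = R_frechet P Q
    + R_apply (fre P (fst Q), fre P (snd Q))"
  by (simp add: R_op_def fre_add fre_pdo_apply coeffs_in_R algebra_simps)

lemma R_apply_minus: "R_apply (P - Q) = R_apply P - R_apply Q"
  using R_apply_add[of "P - Q" Q] by (simp add: eq_diff_eq)

text \<open>By \<open>fre_R_apply\<close>, differentiating R Q along P gives R'[P] Q plus R applied
  to the derivative of Q. In the torsion all derivatives of P and Q themselves cancel, and exactly
  the difference of the two sides of the symmetric form remains.\<close>

lemma nijenhuis_bracket_if_symmetric: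
  assumes "nijenhuis_symmetric act D R_op"
  shows "nijenhuis_bracket act D fre R_op"
proof -
  define F where "F P Q = (fre P (fst Q), fre P (snd Q))" for P Q
  have br: "lie_bracket fre P Q = F P Q - F Q P" for P Q
    by (simp add: lie_bracket_def F_def)
  have F: "F P (R_apply Q) = R_frechet P Q + R_apply (F P Q)" for P Q
    unfolding F_def by (rule fre_R_apply)
  have "lie_bracket fre (R_apply P) (R_apply Q) - R_apply (lie_bracket fre (R_apply P) Q)
      - R_apply (lie_bracket fre P (R_apply Q)) + R_apply (R_apply (lie_bracket fre P Q))
      = (R_frechet (R_apply P) Q - R_apply (R_frechet P Q)) - (R_frechet (R_apply Q) P
          - R_apply (R_frechet Q P))" for P Q
    by (simp only: br F R_apply_add R_apply_minus) (simp add: algebra_simps)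
  then show ?thesis
    using assms unfolding nijenhuis_bracket_def nijenhuis_symmetric_def Let_def by simp
qed

end

theorem theorem4:
  fixes act :: "(jet \<Rightarrow> real) \<Rightarrow> 'm::comm_ring \<Rightarrow> 'm"
    and D :: "'m \<Rightarrow> 'm"
  assumes "nonlocal_extension act D"
  shows "nijenhuis act D R_op"
proof -
  interpret nonlocal_extension act D by (rule assms)
  have sym: "nijenhuis_symmetric act D R_op"
    by (rule nijenhuis_symmetric_R)
  have "nijenhuis_bracket act D fre R_op" if "frechet_extension act D fre" for fre
    using that sym by (rule frechet_extension.nijenhuis_bracket_if_symmetric)
  with sym show ?thesis by (simp add: nijenhuis_def)
qed

end
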